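(* Let $\alpha\in(0,1)$ be an irrational number of bounded type, $Tx=x+\alpha$ on $\mathbb T$, and let $\beta,\gamma\in[0,1)$. Then the cocycle $\Phi_2=(1_{[0,\beta)}-\beta,\;1_{[0,\gamma)}-\gamma):\mathbb T\to\mathbb R^2$ is regular over $T$.
   Context: $\mathbb T=[0,1)$ is the additive circle (addition mod $1$) with Lebesgue measure $\mu$. An irrational $\alpha=[0;a_1,a_2,\dots]$ is of bounded type if its sequence of partial quotients $(a_n)$ is bounded. A measurable function $\Phi:\mathbb T\to\mathbb R^m$ is called a cocycle over $T$. Two cocycles $\Phi,\Psi:\mathbb T\to\mathbb R^m$ are cohomologous if $\Phi-\Psi=f-f\circ T$ a.e. for some measurable $f:\mathbb T\to\mathbb R^m$. A cocycle $\Phi:\mathbb T\to\mathbb R^m$ is regular if it is cohomologous to a cocycle $\Psi$ taking values in a closed subgroup $H\subset\mathbb R^m$ such that $T_\Psi(x,h)=(Tx,h+\Psi(x))$ is ergodic on $\mathbb T\times H$ for the product of $\mu$ and Haar measure on $H$. *)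

theory Defs
  imports "HOL-Analysis.Analysis"
begin

text \<open>Continued fraction \<open>x = [a\<^sub>0; a\<^sub>1, a\<^sub>2, \<dots>]\<close>: the complete quotients are
  \<open>x\<^sub>0 = x\<close>, \<open>x\<^sub>n\<^sub>+\<^sub>1 = 1 / (x\<^sub>n - \<lfloor>x\<^sub>n\<rfloor>)\<close>, and \<open>a\<^sub>n = \<lfloor>x\<^sub>n\<rfloor>\<close>. For irrational \<open>x\<close> the expansion
  does not terminate and no division by zero occurs.\<close>

primrec complete_quotient :: "real \<Rightarrow> nat \<Rightarrow> real" where
  "complete_quotient x 0 = x"
| "complete_quotient x (Suc n) = 1 / frac (complete_quotient x n)"

definition partial_quotient :: "real \<Rightarrow> nat \<Rightarrow> int" where
  "partial_quotient x n = \<lfloor>complete_quotient x n\<rfloor>"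

definition bounded_type :: "real \<Rightarrow> bool" where
  "bounded_type x \<longleftrightarrow> x \<notin> \<rat> \<and> (\<exists>K. \<forall>n\<ge>1. partial_quotient x n \<le> K)"

text \<open>The circle is modelled by its fundamental domain \<open>[0,1)\<close>. Functions on it are functions on
  \<^typ>\<open>real\<close> of which only the values on \<open>[0,1)\<close> matter. Measurability is Borel measurability.\<close>

definition circle :: "real measure" where
  "circle = restrict_space lborel {0..<1}"

definition rotation :: "real \<Rightarrow> real \<Rightarrow> real" where
  "rotation \<alpha> x = frac (x + \<alpha>)"

definition cocycle :: "(real \<Rightarrow> 'a::euclidean_space) \<Rightarrow> bool" where
  "cocycle \<Phi> \<longleftrightarrow> \<Phi> \<in> borel_measurable circle"

definition cohomologous ::
  "(real \<Rightarrow> real) \<Rightarrow> (real \<Rightarrow> 'a::euclidean_space) \<Rightarrow> (real \<Rightarrow> 'a) \<Rightarrow> bool" where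
  "cohomologous T \<Phi> \<Psi> \<longleftrightarrow>
     (\<exists>f \<in> borel_measurable circle. AE x in circle. \<Phi> x - \<Psi> x = f x - f (T x))"

definition closed_subgroup :: "'a::euclidean_space set \<Rightarrow> bool" where
  "closed_subgroup H \<longleftrightarrow> closed H \<and> 0 \<in> H \<and> (\<forall>x\<in>H. \<forall>y\<in>H. x - y \<in> H)"

text \<open>A closed subgroup of a Euclidean space is locally compact and second countable, so a Borel
  measure on it that is finite on compact sets is automatically regular.\<close>

definition haar_measure_on :: "'a::euclidean_space set \<Rightarrow> 'a measure \<Rightarrow> bool" where
  "haar_measure_on H \<nu> \<longleftrightarrow>
     space \<nu> = H \<and> sets \<nu> = sets (restrict_space borel H) \<and>
     emeasure \<nu> H \<noteq> 0 \<and>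
     (\<forall>K. compact K \<and> K \<subseteq> H \<longrightarrow> emeasure \<nu> K < \<infinity>) \<and>
     (\<forall>h\<in>H. \<forall>A\<in>sets \<nu>. emeasure \<nu> ((+) h ` A) = emeasure \<nu> A)"

definition measure_preserving :: "'b measure \<Rightarrow> ('b \<Rightarrow> 'b) \<Rightarrow> bool" where
  "measure_preserving M S \<longleftrightarrow> S \<in> measurable M M \<and> distr M M S = M"

text \<open>The measure may be infinite, so an invariant set has to be null or co-null.\<close>

definition ergodic :: "'b measure \<Rightarrow> ('b \<Rightarrow> 'b) \<Rightarrow> bool" where
  "ergodic M S \<longleftrightarrow> measure_preserving M S \<and>
     (\<forall>A\<in>sets M. S -` A \<inter> space M = A \<longrightarrow>
        emeasure M A = 0 \<or> emeasure M (space M - A) = 0)"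

definition skew_product ::
  "(real \<Rightarrow> real) \<Rightarrow> (real \<Rightarrow> 'a::euclidean_space) \<Rightarrow> real \<times> 'a \<Rightarrow> real \<times> 'a" where
  "skew_product T \<Psi> = (\<lambda>(x, h). (T x, h + \<Psi> x))"

text \<open>Haar measure is unique up to a positive factor, which affects neither invariance nor
  null sets; hence it does not matter which Haar measure \<open>\<nu>\<close> on \<open>H\<close> is taken.\<close>

definition regular_cocycle :: "(real \<Rightarrow> real) \<Rightarrow> (real \<Rightarrow> 'a::euclidean_space) \<Rightarrow> bool" where
  "regular_cocycle T \<Phi> \<longleftrightarrow> cocycle \<Phi> \<and>
     (\<exists>\<Psi> H \<nu>. cocycle \<Psi> \<and> cohomologous T \<Phi> \<Psi> \<and>
        closed_subgroup H \<and> (\<forall>x\<in>{0..<1}. \<Psi> x \<in> H) \<and>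
        haar_measure_on H \<nu> \<and> ergodic (circle \<Otimes>\<^sub>M \<nu>) (skew_product T \<Psi>))"

end

theory Submission
  imports Defs
begin

text \<open>Write the centred indicator of \<open>[0, b)\<close> as \<open>frac (x - b) - frac x\<close>. If \<open>b\<close> and \<open>b'\<close> differ
  by an element of \<open>\<int> \<alpha> + \<int>\<close>, the cocycles of \<open>b\<close> and \<open>b'\<close> are cohomologous, so one may assume that
  distinct discontinuities lie in distinct classes modulo \<open>\<int> \<alpha> + \<int>\<close>. Because \<open>\<alpha>\<close> is badly approximable,
  there are then infinitely many denominators \<open>q\<close> at which some discontinuity of the Birkhoff sum of
  length \<open>q\<close> stays at distance of order \<open>1 / q\<close> from all the others. By the Denjoy-Koksma bound the
  Birkhoff sums are bounded, and comparing an invariant set of the skew product with itself on the two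
  sides of such a jump shows that the jump is a period of the invariant set, up to null sets. In this way
  the whole lattice generated by the jumps consists of periods. Modulo this lattice the skew product is
  a translation, so invariant sets are invariant under a closed group \<open>K\<close> of translations of
  \<open>\<real> \<times> \<real>\<^sup>2\<close> that projects onto the first factor. The fibre of \<open>K\<close> over \<open>0\<close> is the group
  \<open>H\<close>, and a Borel section of \<open>K\<close> provides the transfer function.\<close>

section \<open>Badly approximable numbers\<close>

text \<open>Invariant sets are lifted to the cover R x R^m, 1-periodic in the first coordinate, so
  that translations, Lebesgue measure and Fubini for vector spaces apply; the circle itself returns
  only when ergodicity is proved. The obstacle is that there are three discontinuities 0, \<beta>,
  \<gamma>. Each of their differences is far from short orbit segments at infinitely many scales,
  but these sequences of scales need not meet. At one scale the triangle inequality controls only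
  two of the differences, so some discontinuity is isolated, but there is no choice of which one.
  Since any two of the jumps u, v, u + v generate the third, a pigeonhole over the scales is still
  enough. Bad approximability also makes the jumps visible: the denominator q found at scale M
  exceeds c M, so q disjoint sets of measure of order 1 / M have total measure bounded below. The
  group H is never computed. It comes from the periods of all invariant sets, so a Haar measure has
  to be built for an arbitrary closed subgroup.\<close>

lemma complete_quotient_Suc_shift:
  "complete_quotient x (Suc n) = complete_quotient (1 / frac x) n"
  by (induction n) auto

lemma irrational_inverse_frac:
  fixes x :: real
  assumes "x \<notin> \<rat>"
  shows "1 / frac x \<notin> \<rat>"
proof
  assume "1 / frac x \<in> \<rat>"
  then have "inverse (1 / frac x) \<in> \<rat>" by (rule Rats_inverse)
  then have "frac x + of_int \<lfloor>x\<rfloor> \<in> \<rat>" by (intro Rats_add) auto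
  with assms show False by (simp add: frac_def)
qed

lemma irrational_frac_pos:
  fixes x :: real
  assumes "x \<notin> \<rat>"
  shows "0 < frac x"
  using assms by (metis frac_gt_0_iff Ints_subset_Rats subsetD)

text \<open>The factor \<open>1 + 1 / q\<close> absorbs the error made in one step \<open>y \<mapsto> 1 / frac y\<close> of the
  continued fraction algorithm, which replaces \<open>q\<close> by a smaller denominator.\<close>

lemma badly_approximable_step:
  fixes y C c :: real and q :: nat and p :: int
  assumes "y \<notin> \<rat>" and "\<forall>n\<ge>1. complete_quotient y n \<le> C"
    and "1 \<le> C" and "c = 1 / (2 * C\<^sup>2)" and "1 \<le> q"
  shows "c * (1 + 1 / q) / q \<le> \<bar>real q * y - real_of_int p\<bar>"
  using assms
proof (induction q arbitrary: y p rule: less_induct)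
  case (less q y p)
  define z where "z = 1 / frac y"
  \<comment> \<open>Since y = floor y + 1 / z, the error q y - p equals (q - p' z) / z: for z the
    new denominator is p' and the new numerator is q.\<close>
  define p' where "p' = p - \<lfloor>y\<rfloor> * int q"
  have zirr: "z \<notin> \<rat>" unfolding z_def by (rule irrational_inverse_frac) fact
  have fpos: "0 < frac y" using irrational_frac_pos less.prems by blast
  have z1: "1 < z" using fpos frac_lt_1[of y] by (simp add: z_def)
  have zC: "z \<le> C" using less.prems(2)[rule_format, of 1] by (simp add: z_def)
  have znC: "complete_quotient z n \<le> C" if "1 \<le> n" for n
  proof -
    have "complete_quotient y (Suc n) \<le> C" by (rule less.prems(2)[rule_format]) simp
    then show ?thesis unfolding complete_quotient_Suc_shift z_def .
  qed
  have eq: "q * y - p = (q - p' * z) / z"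
  proof -
    have "y = \<lfloor>y\<rfloor> + 1 / z" by (simp add: z_def frac_def)
    then have "q * y = q * (\<lfloor>y\<rfloor> + 1 / z)" by (rule arg_cong)
    also have "\<dots> = q * \<lfloor>y\<rfloor> + q / z" by (simp add: distrib_left)
    finally have "q * y - p = q / z - p'" by (simp add: p'_def)
    then show ?thesis using z1 by (simp add: diff_divide_distrib)
  qed
  have q1: "1 \<le> real q" using less.prems by simp
  have c0: "0 < c" using less.prems by simp
  have cC: "2 * c = 1 / C\<^sup>2" using less.prems by simp
  have le2c: "c * (1 + 1 / q) / q \<le> 2 * c"
  proof -
    have "c * (1 + 1 / q) \<le> c * 2" using q1 c0 by (intro mult_left_mono) (auto simp: field_simps)
    then have "c * (1 + 1 / q) / q \<le> c * 2 / 1" using q1 c0 by (intro frac_le) auto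
    then show ?thesis by simp
  qed
  have C2: "1 / C\<^sup>2 \<le> 1 / C"
    using less.prems(3) by (simp add: power2_eq_square field_simps mult_le_cancel_left1)
  have zC': "1 / C \<le> 1 / z" using z1 zC by (simp add: frac_le)
  \<comment> \<open>Outside 0 < p' < q the error is at least 1 / C^2 = 2 c, which dominates the
    claim because 1 + 1 / q is at most 2. Only the last case needs induction.\<close>
  consider "p' \<le> 0" | "int q \<le> p'" | "0 < p'" "p' < int q" by linarith
  then show ?case
  proof cases
    case 1
    have "p' * z \<le> 0" using 1 z1 by (simp add: mult_nonpos_nonneg)
    then have "1 / z \<le> (q - p' * z) / z" using z1 q1 by (intro divide_right_mono) auto
    then have "1 / z \<le> q * y - p" by (simp only: eq)
    then show ?thesis using le2c cC C2 zC' by linarith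
  next
    case 2
    have "1 / C \<le> frac z"
    proof -
      have "complete_quotient z 1 \<le> C" by (rule znC) simp
      moreover have "0 < frac z" by (rule irrational_frac_pos) fact
      ultimately show ?thesis using less.prems(3) by (simp add: field_simps)
    qed
    moreover have "frac z \<le> z - 1" using z1 by (simp add: frac_def)
    ultimately have "1 / C \<le> z - 1" by linarith
    moreover have "1 * (z - 1) \<le> real q * (z - 1)" using q1 z1 by (intro mult_right_mono) auto
    moreover have "q * z \<le> p' * z" using 2 z1 by (intro mult_right_mono) auto
    ultimately have "1 / C \<le> p' * z - q" by (simp add: algebra_simps)
    then have "(1 / C) / z \<le> (p' * z - q) / z" using z1 by (intro divide_right_mono) auto
    moreover have "(1 / C) / C \<le> (1 / C) / z" using z1 zC by (intro divide_left_mono) auto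
    moreover have "(1 / C) / C = 1 / C\<^sup>2" by (simp add: power2_eq_square)
    moreover have "(p' * z - q) / z = - (q * y - p)" using eq by (simp add: minus_divide_left)
    ultimately show ?thesis using le2c cC by linarith
  next
    case 3
    define r where "r = nat p'"
    have r: "p' = int r" "1 \<le> r" "r < q" using 3 by (auto simp: r_def)
    then have q2: "2 \<le> q" by simp
    have "c * (1 + 1 / r) / r \<le> \<bar>r * z - int q\<bar>"
      by (rule less.IH) (use r zirr znC less.prems in auto)
    then have IH: "c * (1 + 1 / r) / r \<le> \<bar>r * z - q\<bar>" by simp
    define d where "d = r * z - q"
    have eq': "\<bar>q * y - p\<bar> = \<bar>d\<bar> / z" using eq z1 r by (simp add: d_def abs_minus_commute)
    show ?thesis
    proof (rule ccontr)
      assume "\<not> ?thesis"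
      then have lt: "\<bar>d\<bar> / z < c * (1 + 1 / q) / q" using eq' by simp
      have "\<bar>d\<bar> < c * (1 + 1 / q) / q * z" using lt z1 by (simp add: pos_divide_less_eq)
      also have "\<dots> \<le> (c * 2 / q) * C"
      proof (intro mult_mono divide_right_mono mult_left_mono)
        show "1 + 1 / real q \<le> 2" using q1 by simp
      qed (use c0 zC z1 q1 in auto)
      also have "\<dots> = (1 / q) * (1 / C)" using less.prems(3,4) by (simp add: power2_eq_square)
      also have "\<dots> \<le> (1 / q) * 1" using less.prems(3) by (intro mult_left_mono) auto
      finally have d: "\<bar>d\<bar> < 1 / q" by simp
      have r0: "0 < real r" "0 < real q" using r by auto
      have rz: "r * z = q + d" by (simp add: d_def)
      have qd: "0 < q + d" using r0 z1 rz by (metis less_trans mult_pos_pos zero_less_one)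
      have "c * (1 + 1 / r) / r / z \<le> \<bar>d\<bar> / z"
        using IH z1 by (intro divide_right_mono) (auto simp: d_def)
      also have "c * (1 + 1 / r) / r / z = c * (1 + 1 / r) / (q + d)"
        by (simp add: rz[symmetric])
      finally have "c * (1 + 1 / r) / (q + d) < c * (1 + 1 / q) / q" using lt by simp
      moreover have cross: "X * B < Y * A" if "0 < A" "0 < B" "X / A < Y / B" for X Y A B :: real
        using that by (simp add: field_simps)
      ultimately have "c * (1 + 1 / r) * q < c * (1 + 1 / q) * (q + d)"
        using r0 qd by blast
      then have "c * ((1 + 1 / r) * q) < c * ((1 + 1 / q) * (q + d))" by (simp only: mult.assoc)
      then have lt1: "(1 + 1 / r) * q < (1 + 1 / q) * (q + d)" using c0 by simp
      have "1 + 1 / (real q - 1) \<le> 1 + 1 / r"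
      proof -
        have "real r \<le> real q - 1" using r by linarith
        then show ?thesis using r0 by (auto intro!: frac_le)
      qed
      then have le1: "(1 + 1 / (real q - 1)) * q \<le> (1 + 1 / r) * q" using r0 by (intro mult_right_mono) auto
      have le2: "(1 + 1 / q) * (q + d) \<le> (1 + 1 / q) * (q + 1 / q)"
        using d r0 by (intro mult_left_mono) auto
      have "(1 + 1 / (real q - 1)) * q < (1 + 1 / q) * (q + 1 / q)"
        by (rule le_less_trans[OF le1 less_le_trans[OF lt1 le2]])
      moreover have "(1 + 1 / (real q - 1)) = q / (real q - 1)" using q2 by (simp add: field_simps)
      moreover have "(1 + 1 / q) * (q + 1 / q) \<le> q / (real q - 1) * q"
      proof -
        \<comment> \<open>The left side is q^4 - 1. The factor 1 + 1 / q in the claim is made for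
          this comparison: with r <= q - 1 and d < 1 / q, the gain in 1 + 1 / r outweighs the loss
          of replacing q by q + d.\<close>
        have "(real q - 1) * ((real q + 1) * ((real q)^2 + 1)) \<le> real q ^ 4"
          by (simp add: power2_eq_square power4_eq_xxxx algebra_simps)
        then show ?thesis using q2 r0
          by (simp add: divide_simps power2_eq_square power4_eq_xxxx algebra_simps)
      qed
      ultimately show False by simp
    qed
  qed
qed

text \<open>The constant is a parameter because the separation distances and the measure of the jump
  sets are expressed through it.\<close>

definition badly_approximable :: "real \<Rightarrow> real \<Rightarrow> bool" where
  "badly_approximable c \<alpha> \<longleftrightarrow> 0 < c \<and> (\<forall>k p :: int. k \<noteq> 0 \<longrightarrow> c / \<bar>real_of_int k\<bar> \<le> \<bar>real_of_int k * \<alpha> - real_of_int p\<bar>)"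

lemma bounded_type_badly_approximable:
  assumes "bounded_type \<alpha>"
  obtains c where "badly_approximable c \<alpha>"
proof -
  obtain K :: int where irr: "\<alpha> \<notin> \<rat>" and K: "\<forall>n\<ge>1. partial_quotient \<alpha> n \<le> K"
    using assms by (auto simp: bounded_type_def)
  define C where "C = max 1 (real_of_int K + 1)"
  define c where "c = 1 / (2 * C\<^sup>2)"
  have C1: "1 \<le> C" by (simp add: C_def)
  have cqC: "\<forall>n\<ge>1. complete_quotient \<alpha> n \<le> C"
  proof (intro allI impI)
    fix n :: nat assume "1 \<le> n"
    then have "\<lfloor>complete_quotient \<alpha> n\<rfloor> \<le> K" using K by (simp add: partial_quotient_def)
    then show "complete_quotient \<alpha> n \<le> C" unfolding C_def by linarith
  qed
  have c0: "0 < c" using C1 by (simp add: c_def)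
  have nat_case: "c / q \<le> \<bar>q * \<alpha> - p\<bar>" if "1 \<le> q" for q :: nat and p :: int
  proof -
    have "c / q \<le> c * (1 + 1 / q) / q" using c0 by (intro divide_right_mono) (auto simp: field_simps)
    also have "\<dots> \<le> \<bar>q * \<alpha> - p\<bar>"
      by (rule badly_approximable_step[OF irr cqC C1 c_def that])
    finally show ?thesis .
  qed
  have "c / \<bar>real_of_int k\<bar> \<le> \<bar>real_of_int k * \<alpha> - real_of_int p\<bar>" if "k \<noteq> 0" for k p :: int
  proof (cases "0 < k")
    case True
    then show ?thesis using nat_case[of "nat k" p] by simp
  next
    case False
    then show ?thesis using nat_case[of "nat (- k)" "- p"] that by (simp add: abs_minus_commute)
  qed
  with c0 show thesis by (intro that[of c]) (auto simp: badly_approximable_def)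
qed

lemma badly_approximable_irrational:
  assumes "badly_approximable c \<alpha>"
  shows "\<alpha> \<notin> \<rat>"
proof
  assume "\<alpha> \<in> \<rat>"
  then obtain a b :: int where "0 < b" "\<alpha> = a / b" by (meson Rats_cases')
  then have "\<bar>b * \<alpha> - a\<bar> = 0" "b \<noteq> 0" by auto
  moreover have "c / \<bar>real_of_int b\<bar> \<le> \<bar>real_of_int b * \<alpha> - real_of_int a\<bar>" "0 < c"
    using assms \<open>b \<noteq> 0\<close> unfolding badly_approximable_def by blast+
  ultimately have "c / \<bar>real_of_int b\<bar> \<le> 0" by linarith
  with \<open>b \<noteq> 0\<close> \<open>0 < c\<close> show False by (simp add: divide_le_0_iff)
qed

section \<open>Scales at which a point is separated from the orbit of 0\<close>

definition on_orbit :: "real \<Rightarrow> real \<Rightarrow> bool" where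
  "on_orbit \<alpha> b \<longleftrightarrow> (\<exists>(k::int) (z::int). b = of_int k * \<alpha> + of_int z)"

text \<open>Two discontinuities at difference b give a Birkhoff sum of length q <= M jumps at points
  whose differences are, modulo 1, of the form b - k \<alpha> with \<bar>k\<bar> < q. The condition
  keeps these jumps \<epsilon> / M apart.\<close>

definition separated :: "real \<Rightarrow> real \<Rightarrow> nat \<Rightarrow> real \<Rightarrow> bool" where
  "separated \<alpha> \<epsilon> M b \<longleftrightarrow> (\<forall>k z :: int. \<bar>k\<bar> \<le> int M \<longrightarrow> \<epsilon> / real M \<le> \<bar>b - real_of_int k * \<alpha> - real_of_int z\<bar>)"

lemma separated_minus: "separated \<alpha> \<epsilon> M (- b) \<longleftrightarrow> separated \<alpha> \<epsilon> M b"
proof -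
  have "separated \<alpha> \<epsilon> M (- b)" if "separated \<alpha> \<epsilon> M b" for b
    unfolding separated_def
  proof (intro allI impI)
    fix k z :: int assume "\<bar>k\<bar> \<le> int M"
    then have "\<epsilon> / M \<le> \<bar>b - of_int (- k) * \<alpha> - of_int (- z)\<bar>"
      using that unfolding separated_def by (metis abs_minus)
    also have "b - of_int (- k) * \<alpha> - of_int (- z) = - (- b - real_of_int k * \<alpha> - real_of_int z)" by simp
    also have "\<bar>\<dots>\<bar> = \<bar>- b - real_of_int k * \<alpha> - real_of_int z\<bar>" by (rule abs_minus)
    finally show "\<epsilon> / M \<le> \<bar>- b - real_of_int k * \<alpha> - real_of_int z\<bar>" .
  qed
  from this[of b] this[of "- b"] show ?thesis by auto
qed

text \<open>If \<open>b\<close> were close to \<open>k\<^sub>N \<alpha> + z\<^sub>N\<close> with \<open>\<bar>k\<^sub>N\<bar> \<le> N\<close> at all large scales \<open>N\<close>, then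
  \<open>k\<^sub>N\<close> would be eventually constant, because \<open>(k\<^sub>N - k\<^sub>N\<^sub>+\<^sub>1) \<alpha>\<close> is too close to an integer.\<close>

lemma frequently_separated:
  assumes bad: "badly_approximable c \<alpha>" and b: "\<not> on_orbit \<alpha> b"
  shows "\<exists>N\<ge>N0. separated \<alpha> (c / 6) N b"
proof (rule ccontr)
  assume contr: "\<not> ?thesis"
  have c0: "0 < c" using bad by (simp add: badly_approximable_def)
  define m where "m = max 1 N0"
  have "\<exists>k z :: int. \<bar>k\<bar> \<le> int N \<and> \<bar>b - real_of_int k * \<alpha> - real_of_int z\<bar> < (c / 6) / real N" if "m \<le> N" for N
  proof -
    have "\<not> separated \<alpha> (c / 6) N b" using contr that by (auto simp: m_def)
    then show ?thesis by (auto simp: separated_def not_le)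
  qed
  then obtain k z :: "nat \<Rightarrow> int" where k: "\<And>N. m \<le> N \<Longrightarrow> \<bar>k N\<bar> \<le> int N"
    and z: "\<And>N. m \<le> N \<Longrightarrow> \<bar>b - real_of_int (k N) * \<alpha> - real_of_int (z N)\<bar> < (c / 6) / N" by metis
  have step: "k (Suc N) = k N" if N: "m \<le> N" for N
  proof (rule ccontr)
    assume "k (Suc N) \<noteq> k N"
    then have ne: "k (Suc N) - k N \<noteq> 0" by simp
    have N1: "1 \<le> N" using N by (simp add: m_def)
    \<comment> \<open>This is the origin of 6: the indices differ by at most 2 N + 1 <= 3 N, so bad
      approximability gives c / (3 N), whereas the two approximation errors sum to less than 2 (c /
      6) / N.\<close>
    have "\<bar>k (Suc N) - k N\<bar> \<le> 3 * int N" using k[of N] k[of "Suc N"] N N1 by linarith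
    then have "c / (3 * N) \<le> c / \<bar>k (Suc N) - k N\<bar>"
      using c0 ne N1 by (intro divide_left_mono mult_pos_pos) auto
    also have "\<dots> \<le> \<bar>real_of_int (k (Suc N) - k N) * \<alpha> - real_of_int (z N - z (Suc N))\<bar>"
      using bad ne unfolding badly_approximable_def by (metis of_int_abs)
    also have "\<dots> = \<bar>(b - k N * \<alpha> - z N) - (b - k (Suc N) * \<alpha> - z (Suc N))\<bar>"
      by (simp add: algebra_simps)
    also have "\<dots> < (c / 6) / N + (c / 6) / Suc N"
      using z[of N] z[of "Suc N"] N by linarith
    also have "\<dots> \<le> (c / 6) / N + (c / 6) / N"
      using c0 N1 by (intro add_mono divide_left_mono) auto
    also have "\<dots> = c / (3 * N)" by simp
    finally show False by simp
  qed
  have const: "k N = k m" if "m \<le> N" for N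
    using that by (induction N rule: dec_induct) (auto simp: step)
  \<comment> \<open>Nothing is known about how \<open>z N\<close> varies, so it is replaced by the
    nearest integer, which does at least as well for every N.\<close>
  have "\<bar>b - k m * \<alpha> - round (b - k m * \<alpha>)\<bar> \<le> (c / 6) / N" if "m \<le> N" for N
  proof -
    have "\<bar>(b - k m * \<alpha>) - round (b - k m * \<alpha>)\<bar> \<le> \<bar>(b - k m * \<alpha>) - z N\<bar>"
      by (rule round_diff_minimal)
    with z[OF that] const[OF that] show ?thesis by simp
  qed
  then have ev: "\<forall>\<^sub>F N in sequentially. \<bar>b - k m * \<alpha> - round (b - k m * \<alpha>)\<bar> \<le> (c / 6) / real N"
    by (auto simp: eventually_sequentially)
  have "\<bar>b - k m * \<alpha> - round (b - k m * \<alpha>)\<bar> \<le> 0"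
    by (rule tendsto_lowerbound[OF lim_const_over_n ev sequentially_bot])
  then have "b = k m * \<alpha> + round (b - k m * \<alpha>)" by simp
  with b show False unfolding on_orbit_def by blast
qed

text \<open>Triangle inequality at half of a scale N where a is separated: if d and a - d were close
  to k \<alpha> and k' \<alpha> with indices up to M = N div 2, then a would be close to (k + k')
  \<alpha> with index at most N. The constant is 36 = 6 * 2 * 3: two errors are added, and N <= 3
  M.\<close>

lemma frequently_separated_dichotomy:
  assumes bad: "badly_approximable c \<alpha>" and a: "\<not> on_orbit \<alpha> a"
  shows "\<exists>M\<ge>N0. separated \<alpha> (c / 36) M a \<and>
    (separated \<alpha> (c / 36) M d \<or> separated \<alpha> (c / 36) M (a - d))"
proof -
  have c0: "0 < c" using bad by (simp add: badly_approximable_def)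
  obtain N where N: "2 * N0 + 2 \<le> N" and sep: "separated \<alpha> (c / 6) N a"
    using frequently_separated[OF bad a, of "2 * N0 + 2"] by auto
  define M where "M = N div 2"
  have M: "N0 \<le> M" "1 \<le> M" "N \<le> 3 * M" "2 * M \<le> N" using N by (auto simp: M_def)
  have scale: "2 * ((c / 36) / M) \<le> (c / 6) / N"
  proof -
    have "real N \<le> 3 * real M" using M(3) by linarith
    then have "(c / 6) / (3 * real M) \<le> (c / 6) / real N"
      using c0 M N by (intro divide_left_mono) auto
    then show ?thesis by simp
  qed
  have pos: "0 < (c / 36) / M" using c0 M by simp
  have far: "2 * ((c / 36) / M) \<le> \<bar>a - real_of_int k * \<alpha> - real_of_int z\<bar>" if "\<bar>k\<bar> \<le> 2 * int M" for k z :: int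
  proof -
    have "\<bar>k\<bar> \<le> int N" using that M by linarith
    then have "(c / 6) / N \<le> \<bar>a - real_of_int k * \<alpha> - real_of_int z\<bar>" using sep unfolding separated_def by blast
    with scale show ?thesis by linarith
  qed
  have "separated \<alpha> (c / 36) M a"
    unfolding separated_def
  proof (intro allI impI)
    fix k z :: int assume "\<bar>k\<bar> \<le> int M"
    then show "c / 36 / M \<le> \<bar>a - real_of_int k * \<alpha> - real_of_int z\<bar>" using far[of k z] pos by linarith
  qed
  moreover have "separated \<alpha> (c / 36) M d \<or> separated \<alpha> (c / 36) M (a - d)"
  proof (rule ccontr)
    assume "\<not> ?thesis"
    then obtain k z k' z' :: int where *: "\<bar>k\<bar> \<le> int M" "\<bar>d - real_of_int k * \<alpha> - real_of_int z\<bar> < c / 36 / M"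
      "\<bar>k'\<bar> \<le> int M" "\<bar>a - d - real_of_int k' * \<alpha> - real_of_int z'\<bar> < c / 36 / M"
      unfolding separated_def not_le by (metis not_le)
    have "2 * ((c / 36) / M) \<le> \<bar>a - of_int (k + k') * \<alpha> - of_int (z + z')\<bar>"
      using * by (intro far) linarith
    also have "\<dots> = \<bar>(d - real_of_int k * \<alpha> - z) + (a - d - real_of_int k' * \<alpha> - z')\<bar>" by (simp add: algebra_simps)
    finally show False using * by linarith
  qed
  ultimately show ?thesis using M by blast
qed

section \<open>The Denjoy-Koksma bound\<close>

text \<open>Hermite's identity. Shifting x by 1 / q shifts the index, and the telescoping difference
  of the end terms is 1; this reduces to x in [0, 1 / q), where all floors vanish.\<close>

lemma sum_floor_shifts:
  fixes x :: real and q :: nat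
  assumes q: "0 < q"
  shows "(\<Sum>j<q. \<lfloor>x + real j / real q\<rfloor>) = \<lfloor>real q * x\<rfloor>"
proof -
  define h where "h = (\<lambda>x::real. \<Sum>j<q. \<lfloor>x + j / q\<rfloor>)"
  have q0: "0 < real q" using q by simp
  have step: "h (x + 1 / q) = h x + 1" for x
  proof -
    have "h (x + 1 / q) = (\<Sum>j<q. \<lfloor>x + Suc j / q\<rfloor>)"
      unfolding h_def by (intro sum.cong refl) (simp add: add_divide_distrib algebra_simps)
    also have "\<dots> = h x + (\<lfloor>x + q / q\<rfloor> - \<lfloor>x + 0 / q\<rfloor>)"
      using sum_lessThan_telescope[of "\<lambda>j. \<lfloor>x + j / q\<rfloor>" q]
      by (simp add: h_def sum_subtractf)
    finally show ?thesis using q by simp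
  qed
  have steps: "h (x + real n / q) = h x + int n" for x n
  proof (induction n)
    case (Suc n)
    have "h (x + real (Suc n) / q) = h (x + real n / q + 1 / q)"
      by (simp add: add_divide_distrib algebra_simps)
    with Suc step show ?case by simp
  qed simp
  have intstep: "h (x + real_of_int k / q) = h x + k" for x k
  proof (cases "0 \<le> k")
    case True
    then show ?thesis using steps[of x "nat k"] by simp
  next
    case False
    then show ?thesis using steps[of "x + real_of_int k / q" "nat (- k)"] by simp
  qed
  have small: "h t = 0" if "0 \<le> t" "t < 1 / q" for t
    unfolding h_def
  proof (intro sum.neutral ballI)
    fix j assume "j \<in> {..<q}"
    then have "real j \<le> real q - 1" by auto
    then have "real j / q \<le> (real q - 1) / q" by (intro divide_right_mono) auto
    also have "\<dots> = 1 - 1 / q" using q0 by (simp add: field_simps)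
    finally have "t + j / q < 1" using that by linarith
    moreover have "0 \<le> t + j / q" using that by simp
    ultimately show "\<lfloor>t + real j / real q\<rfloor> = 0" by linarith
  qed
  have "h x = h (frac (q * x) / q + real_of_int \<lfloor>q * x\<rfloor> / q)"
    using q0 by (simp add: add_divide_distrib[symmetric] frac_def)
  also have "\<dots> = \<lfloor>q * x\<rfloor>"
    using intstep[of "frac (q * x) / q" "\<lfloor>q * x\<rfloor>"] small[of "frac (q * x) / q"] frac_lt_1[of "q * x"] q0
    by (simp add: divide_strict_right_mono)
  finally show ?thesis by (simp add: h_def)
qed

text \<open>The orbit of length \<open>q\<close> lies within \<open>1 / q\<close> of a translate of the multiples of \<open>1 / q\<close>.\<close>

lemma sum_floor_orbit:
  fixes \<alpha> :: real and q :: nat and p :: int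
  assumes q: "0 < q" and cop: "coprime p (int q)" and approx: "\<bar>q * \<alpha> - p\<bar> \<le> 1 / q"
  obtains S :: int where "\<And>x. \<bar>real_of_int (\<Sum>j<q. \<lfloor>x + real j * \<alpha>\<rfloor>) - (real q * x + real_of_int S)\<bar> \<le> 2"
proof -
  define S where "S = (\<Sum>j<q. (int j * p) div int q)"
  define \<rho> where "\<rho> j = nat ((int j * p) mod int q)" for j
  have q0: "0 < real q" using q by simp
  have inj: "inj_on \<rho> {..<q}"
  proof (rule inj_onI)
    fix i j assume ij: "i \<in> {..<q}" "j \<in> {..<q}" and "\<rho> i = \<rho> j"
    then have "(int i * p) mod int q = (int j * p) mod int q"
      using q by (simp add: \<rho>_def nat_eq_iff)
    then have "int q dvd int i * p - int j * p" by (simp add: mod_eq_dvd_iff)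
    then have "int q dvd (int i - int j) * p" by (simp add: algebra_simps)
    then have "int q dvd int i - int j"
      using cop by (simp add: coprime_dvd_mult_left_iff coprime_commute)
    then have "int i mod int q = int j mod int q" by (simp add: mod_eq_dvd_iff)
    with ij show "i = j" by simp
  qed
  have "\<rho> ` {..<q} \<subseteq> {..<q}"
    using q by (auto simp: \<rho>_def nat_less_iff)
  with inj have bij: "bij_betw \<rho> {..<q} {..<q}"
    by (simp add: bij_betw_def endo_inj_surj)
  \<comment> \<open>For p / q in place of \<alpha> the residues j p mod q run through all multiples
    of 1 / q, which leads to Hermite's identity; the integer parts add up to S, whatever x
    is.\<close>
  have rational: "(\<Sum>j<q. \<lfloor>x + j * (p / q)\<rfloor>) = \<lfloor>q * x\<rfloor> + S" for x :: real
  proof -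
    have "\<lfloor>x + j * (p / q)\<rfloor> = \<lfloor>x + \<rho> j / q\<rfloor> + (int j * p) div int q" for j
    proof -
      have "int j * p = (int j * p) div int q * int q + int (\<rho> j)"
        using q by (simp add: \<rho>_def)
      then have "real j * p = real_of_int ((int j * p) div int q) * q + \<rho> j"
        by (metis of_int_add of_int_mult of_int_of_nat_eq)
      then have "j * (p / q) = real_of_int ((int j * p) div int q) + \<rho> j / q"
        using q0 by (simp add: field_simps)
      then show ?thesis by (metis add.assoc add.commute floor_add_int)
    qed
    then have "(\<Sum>j<q. \<lfloor>x + j * (p / q)\<rfloor>) = (\<Sum>j<q. \<lfloor>x + \<rho> j / q\<rfloor>) + S"
      by (simp add: sum.distrib S_def)
    also have "(\<Sum>j<q. \<lfloor>x + \<rho> j / q\<rfloor>) = (\<Sum>j<q. \<lfloor>x + j / q\<rfloor>)"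
      by (rule sum.reindex_bij_betw[OF bij])
    finally show ?thesis using sum_floor_shifts[OF q] by simp
  qed
  have close: "\<bar>j * \<alpha> - j * (p / q)\<bar> \<le> 1 / q" if "j < q" for j
  proof -
    have "\<bar>j * \<alpha> - j * (p / q)\<bar> = \<bar>(j / q) * (q * \<alpha> - p)\<bar>"
      using q0 by (simp add: right_diff_distrib)
    also have "\<dots> = (j / q) * \<bar>q * \<alpha> - p\<bar>" by (simp add: abs_mult)
    also have "\<dots> \<le> 1 * (1 / q)" using that approx by (intro mult_mono) auto
    finally show ?thesis by simp
  qed
  have "\<bar>real_of_int (\<Sum>j<q. \<lfloor>x + real j * \<alpha>\<rfloor>) - (real q * x + real_of_int S)\<bar> \<le> 2" for x :: real
  proof -
    have "(\<Sum>j<q. \<lfloor>x + j * \<alpha>\<rfloor>) \<le> (\<Sum>j<q. \<lfloor>x + 1 / q + j * (p / q)\<rfloor>)"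
    proof (intro sum_mono floor_mono)
      fix j assume "j \<in> {..<q}"
      then show "x + j * \<alpha> \<le> x + 1 / q + j * (p / q)" using close[of j] by auto
    qed
    then have up: "(\<Sum>j<q. \<lfloor>x + j * \<alpha>\<rfloor>) \<le> \<lfloor>q * (x + 1 / q)\<rfloor> + S" by (simp only: rational)
    have "(\<Sum>j<q. \<lfloor>x - 1 / q + j * (p / q)\<rfloor>) \<le> (\<Sum>j<q. \<lfloor>x + j * \<alpha>\<rfloor>)"
    proof (intro sum_mono floor_mono)
      fix j assume "j \<in> {..<q}"
      then show "x - 1 / q + j * (p / q) \<le> x + j * \<alpha>" using close[of j] by auto
    qed
    then have lo: "\<lfloor>q * (x - 1 / q)\<rfloor> + S \<le> (\<Sum>j<q. \<lfloor>x + j * \<alpha>\<rfloor>)" by (simp only: rational)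
    \<comment> \<open>Enclosing the orbit between the rational ones started at x - 1 / q and x + 1 /
      q costs 1, and the floor costs at most 1 more: hence the bound 2.\<close>
    have e: "q * (x + 1 / q) = q * x + 1" "q * (x - 1 / q) = q * x - 1"
      using q0 by (simp_all add: field_simps)
    show ?thesis using up lo unfolding e by linarith
  qed
  then show thesis by (rule that)
qed

section \<open>Translations preserving a set up to null sets\<close>

lemma emeasure_lborel_translate:
  fixes X :: "'a::euclidean_space set"
  assumes "X \<in> sets borel"
  shows "emeasure lborel {p. p + s \<in> X} = emeasure lborel X"
proof -
  have "emeasure lborel X = emeasure (distr lborel borel ((+) s)) X" by (simp add: lborel_distr_plus)
  also have "\<dots> = emeasure lborel {p. p + s \<in> X}"
    using assms by (subst emeasure_distr) (auto simp: vimage_def add.commute)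
  finally show ?thesis by simp
qed

lemma AE_lborel_translate:
  fixes P :: "'a::euclidean_space \<Rightarrow> bool"
  assumes "AE p in lborel. P p"
  shows "AE p in lborel. P (p + s)"
proof -
  have "AE p in distr lborel borel ((+) s). P p"
    unfolding lborel_distr_plus by (rule assms)
  from AE_distrD[OF _ this] have "AE p in lborel. P (s + p)" by simp
  then show ?thesis by (simp add: add.commute)
qed

lemma borel_vimage_translate:
  fixes X :: "'a::euclidean_space set"
  assumes "X \<in> sets borel"
  shows "{p. p + s \<in> X} \<in> sets borel"
proof -
  have "(\<lambda>p. p + s) -` X \<inter> space borel \<in> sets borel"
    by (rule measurable_sets[OF _ assms]) simp
  then show ?thesis by (simp add: vimage_def)
qed

section \<open>The closed group of almost sure periods of a Borel set\<close>

definition mismatch :: "'a::euclidean_space set \<Rightarrow> 'a \<Rightarrow> 'a set" where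
  "mismatch B s = {p. (p + s \<in> B) \<noteq> (p \<in> B)}"

lemma mismatch_borel:
  assumes "B \<in> sets borel"
  shows "mismatch B s \<in> sets borel"
proof -
  have "mismatch B s = ({p. p + s \<in> B} - B) \<union> (B - {p. p + s \<in> B})" by (auto simp: mismatch_def)
  then show ?thesis using assms borel_vimage_translate[OF assms, of s] by auto
qed

text \<open>Local continuity of translation in measure. Near the ball, B is enclosed between a
  compact C and an open U with small gaps. A shift shorter than the distance at which C still stays
  in U can change membership only in the two gaps or their translates, hence the four sets of
  measure at most \<epsilon> / 4.\<close>

lemma mismatch_tendsto_zero:
  fixes B :: "'a::euclidean_space set"
  assumes B: "B \<in> sets borel" and \<epsilon>: "0 < \<epsilon>"
  shows "\<exists>d>0. \<forall>s. norm s < d \<longrightarrow> emeasure lborel (mismatch B s \<inter> cball 0 R) \<le> ennreal \<epsilon>"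
proof -
  define B' where "B' = B \<inter> cball 0 (R + 1)"
  have B': "B' \<in> sets borel" "bounded B'" using B by (auto simp: B'_def)
  have BL: "B' \<in> sets lebesgue" "0 < \<epsilon> / 4" using B' \<epsilon> by auto
  obtain U where U: "open U" "B' \<subseteq> U" "emeasure lebesgue (U - B') < ennreal (\<epsilon> / 4)"
    by (rule sets_lebesgue_outer_open[OF BL])
  obtain C where C: "closed C" "C \<subseteq> B'" "emeasure lebesgue (B' - C) < ennreal (\<epsilon> / 4)"
    by (rule sets_lebesgue_inner_closed[OF BL])
  have "compact C" using C B' by (meson bounded_subset compact_eq_bounded_closed)
  then obtain d where d: "0 < d" "(\<Union>x\<in>C. ball x d) \<subseteq> U"
    using compact_subset_open_imp_ball_epsilon_subset[of C U] U C by blast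
  have bo: "U - B' \<in> sets borel" "B' - C \<in> sets borel" using U C B' by auto
  have small: "emeasure lborel (U - B') \<le> ennreal (\<epsilon> / 4)" "emeasure lborel (B' - C) \<le> ennreal (\<epsilon> / 4)"
    using U(3) C(3) bo by (simp_all add: less_imp_le)
  have "emeasure lborel (mismatch B s \<inter> cball 0 R) \<le> ennreal \<epsilon>" if s: "norm s < min d 1" for s
  proof -
    define X1 X2 X3 X4 where "X1 = {p. p + s \<in> B' - C}" and "X2 = B' - C" and "X3 = U - B'"
      and "X4 = {p. p + s \<in> U - B'}"
    note X = X1_def X2_def X3_def X4_def
    have bX: "X1 \<in> sets borel" "X2 \<in> sets borel" "X3 \<in> sets borel" "X4 \<in> sets borel"
      using bo borel_vimage_translate[OF bo(1), of s] borel_vimage_translate[OF bo(2), of s]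
      unfolding X by (simp_all only:)
    have "mismatch B s \<inter> cball 0 R \<subseteq> (X1 \<union> X2) \<union> (X3 \<union> X4)"
    proof
      fix p assume p: "p \<in> mismatch B s \<inter> cball 0 R"
      then have n: "norm p \<le> R" by simp
      have n': "norm (p + s) \<le> R + 1" using n s norm_triangle_ineq[of p s] by linarith
      have inU: "p + s \<in> U" if "p \<in> C"
        using d that s by (auto simp: dist_norm intro!: subsetD[OF d(2)])
      have inU': "p \<in> U" if "p + s \<in> C"
      proof -
        have "p \<in> ball (p + s) d" using s by (simp add: dist_norm)
        then show ?thesis using d that by blast
      qed
      show "p \<in> (X1 \<union> X2) \<union> (X3 \<union> X4)"
        using p n n' inU inU' by (auto simp: X mismatch_def B'_def)
    qed
    then have "emeasure lborel (mismatch B s \<inter> cball 0 R) \<le> emeasure lborel ((X1 \<union> X2) \<union> (X3 \<union> X4))"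
      using bX by (intro emeasure_mono) auto
    also have "\<dots> \<le> (emeasure lborel X1 + emeasure lborel X2) + (emeasure lborel X3 + emeasure lborel X4)"
      using bX by (intro order_trans[OF emeasure_subadditive] add_mono) auto
    also have "\<dots> \<le> (ennreal (\<epsilon> / 4) + ennreal (\<epsilon> / 4)) + (ennreal (\<epsilon> / 4) + ennreal (\<epsilon> / 4))"
    proof (intro add_mono)
      show "emeasure lborel X1 \<le> ennreal (\<epsilon> / 4)"
        unfolding X1_def by (subst emeasure_lborel_translate) (use bo small in auto)
      show "emeasure lborel X4 \<le> ennreal (\<epsilon> / 4)"
        unfolding X4_def by (subst emeasure_lborel_translate) (use bo small in auto)
    qed (use small in \<open>auto simp: X\<close>)
    also have "\<dots> = ennreal \<epsilon>" using \<epsilon> by (simp add: ennreal_plus[symmetric] del: ennreal_plus)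
    finally show ?thesis .
  qed
  then show ?thesis using d by (intro exI[of _ "min d 1"]) auto
qed

definition ae_periods :: "'a::euclidean_space set \<Rightarrow> 'a set" where
  "ae_periods B = {k. AE p in lborel. p + k \<in> B \<longleftrightarrow> p \<in> B}"

lemma ae_periods_0: "0 \<in> ae_periods B"
  by (simp add: ae_periods_def)

lemma ae_periods_diff:
  assumes "k \<in> ae_periods B" "l \<in> ae_periods B"
  shows "k - l \<in> ae_periods B"
proof -
  have "AE p in lborel. p + k \<in> B \<longleftrightarrow> p \<in> B" "AE p in lborel. p + l \<in> B \<longleftrightarrow> p \<in> B"
    using assms by (auto simp: ae_periods_def)
  from AE_lborel_translate[OF this(1), of "- l"] AE_lborel_translate[OF this(2), of "- l"]
  have "AE p in lborel. p + (k - l) \<in> B \<longleftrightarrow> p \<in> B"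
    by eventually_elim (simp add: algebra_simps)
  then show ?thesis by (simp add: ae_periods_def)
qed

lemma ae_periods_minus: "k \<in> ae_periods B \<Longrightarrow> - k \<in> ae_periods B"
  using ae_periods_diff[OF ae_periods_0, of k B] by simp

lemma ae_periods_add: "k \<in> ae_periods B \<Longrightarrow> l \<in> ae_periods B \<Longrightarrow> k + l \<in> ae_periods B"
  using ae_periods_diff[OF _ ae_periods_minus, of k B l] by simp

lemma ae_periods_of_nat: "k \<in> ae_periods B \<Longrightarrow> real n *\<^sub>R k \<in> ae_periods B"
proof (induction n)
  case (Suc n)
  then have "k + real n *\<^sub>R k \<in> ae_periods B" by (intro ae_periods_add) auto
  then show ?case by (simp add: scaleR_add_left)
qed (simp add: ae_periods_0)

lemma ae_periods_of_int:
  assumes "k \<in> ae_periods B"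
  shows "real_of_int n *\<^sub>R k \<in> ae_periods B"
proof (cases "0 \<le> n")
  case True
  then show ?thesis using ae_periods_of_nat[OF assms, of "nat n"] by simp
next
  case False
  then show ?thesis using ae_periods_minus[OF ae_periods_of_nat[OF assms, of "nat (- n)"]] by simp
qed

lemma null_set_mismatch:
  assumes "B \<in> sets borel" "k \<in> ae_periods B"
  shows "emeasure lborel (mismatch B k) = 0"
proof -
  have "AE p in lborel. p \<notin> mismatch B k" using assms by (auto simp: ae_periods_def mismatch_def)
  then show ?thesis using mismatch_borel[OF assms(1), of k]
    by (simp add: AE_iff_null_sets[symmetric] null_setsD1)
qed

text \<open>If periods \<open>f n\<close> tend to k, a point whose membership changes under k
  changes under \<open>f n\<close>, a null event, or afterwards under the short shift k -
  \<open>f n\<close>. The latter is rare on bounded sets.\<close>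

lemma closed_ae_periods:
  fixes B :: "'a::euclidean_space set"
  assumes B: "B \<in> sets borel"
  shows "closed (ae_periods B)"
  unfolding closed_sequential_limits
proof (intro allI impI, elim conjE)
  fix f :: "nat \<Rightarrow> 'a" and k assume f: "\<forall>n. f n \<in> ae_periods B" and lim: "f \<longlonglongrightarrow> k"
  have small: "emeasure lborel (mismatch B k \<inter> cball 0 R) \<le> ennreal \<epsilon>" if \<epsilon>: "0 < \<epsilon>" for R \<epsilon>
  proof -
    obtain d where d: "0 < d"
      "\<And>s. norm s < d \<Longrightarrow> emeasure lborel (mismatch B s \<inter> cball 0 (R + norm k + 1)) \<le> ennreal \<epsilon>"
      using mismatch_tendsto_zero[OF B \<epsilon>, of "R + norm k + 1"] by blast
    have "\<forall>\<^sub>F n in sequentially. dist (f n) k < min d 1"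
      using d by (intro tendstoD[OF lim]) simp
    then obtain n where n: "norm (f n - k) < d" "norm (f n - k) < 1"
      by (auto simp: eventually_sequentially dist_norm)
    have n': "norm (f n) \<le> norm k + 1" using n(2) norm_triangle_ineq[of "f n - k" k] by simp
    define Y where "Y = mismatch B (k - f n) \<inter> cball 0 (R + norm k + 1)"
    have Y: "Y \<in> sets borel" using mismatch_borel[OF B] by (auto simp: Y_def)
    have "mismatch B k \<inter> cball 0 R \<subseteq> mismatch B (f n) \<union> {p. p + f n \<in> Y}"
    proof
      fix p assume p: "p \<in> mismatch B k \<inter> cball 0 R"
      then have "norm (p + f n) \<le> R + norm k + 1" using n' norm_triangle_ineq[of p "f n"] by simp
      then show "p \<in> mismatch B (f n) \<union> {p. p + f n \<in> Y}"
        using p by (auto simp: mismatch_def Y_def algebra_simps)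
    qed
    then have "emeasure lborel (mismatch B k \<inter> cball 0 R)
        \<le> emeasure lborel (mismatch B (f n) \<union> {p. p + f n \<in> Y})"
      using mismatch_borel[OF B] borel_vimage_translate[OF Y] by (intro emeasure_mono) auto
    also have "\<dots> \<le> emeasure lborel (mismatch B (f n)) + emeasure lborel {p. p + f n \<in> Y}"
      using mismatch_borel[OF B] borel_vimage_translate[OF Y] by (intro emeasure_subadditive) auto
    also have "\<dots> = emeasure lborel Y"
      using null_set_mismatch[OF B] f emeasure_lborel_translate[OF Y] by simp
    also have "\<dots> \<le> ennreal \<epsilon>"
      unfolding Y_def using n by (intro d) (simp add: norm_minus_commute)
    finally show ?thesis .
  qed
  have "emeasure lborel (mismatch B k \<inter> cball 0 R) = 0" for R
  proof -
    have "emeasure lborel (mismatch B k \<inter> cball 0 R) \<le> 0"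
      by (rule ennreal_le_epsilon) (use small[of _ R] in auto)
    then show ?thesis by simp
  qed
  then have "(\<Union>n::nat. mismatch B k \<inter> cball 0 (real n)) \<in> null_sets lborel"
    using mismatch_borel[OF B] by (intro null_sets_UN) auto
  moreover have "(\<Union>n::nat. mismatch B k \<inter> cball 0 (real n)) = mismatch B k"
    by (auto intro: real_arch_simple)
  ultimately have "AE p in lborel. p \<notin> mismatch B k"
    by (simp add: AE_not_in)
  then show "k \<in> ae_periods B" by (auto simp: ae_periods_def mismatch_def)
qed

lemma AE_lborel_witness:
  fixes P :: "'a::euclidean_space \<Rightarrow> bool"
  assumes "AE p in lborel. P p"
  shows "\<exists>p. P p"
proof (rule ccontr)
  assume "\<not> ?thesis"
  then have "AE p in (lborel :: 'a measure). p \<notin> UNIV" using assms by simp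
  then have "UNIV \<in> null_sets (lborel :: 'a measure)" by (subst (asm) AE_iff_null_sets[symmetric]) auto
  then show False by (simp add: null_sets_def)
qed

text \<open>Fubini turns "for every k, almost every p" into "for some p, almost every k"; membership
  in B is then almost everywhere that of this single p.\<close>

lemma null_or_conull_of_ae_periods:
  fixes B :: "'a::euclidean_space set"
  assumes B: "B \<in> sets borel" and all: "ae_periods B = UNIV"
  shows "B \<in> null_sets lborel \<or> - B \<in> null_sets lborel"
proof -
  have "{x \<in> space (lborel \<Otimes>\<^sub>M lborel). fst x + snd x \<in> B \<longleftrightarrow> snd x \<in> B} \<in> sets (lborel \<Otimes>\<^sub>M (lborel::'a measure))"
    using B by measurable
  then have "(AE k in lborel. AE p in lborel. k + p \<in> B \<longleftrightarrow> p \<in> B) \<longleftrightarrow>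
      (AE p in lborel. AE k in lborel. k + p \<in> B \<longleftrightarrow> p \<in> B)"
    by (rule lborel_pair.AE_commute)
  moreover have "AE k in lborel. AE p in lborel. k + p \<in> B \<longleftrightarrow> p \<in> B"
    using all by (auto simp: ae_periods_def add.commute)
  ultimately obtain p where "AE k in lborel. k + p \<in> B \<longleftrightarrow> p \<in> B"
    using AE_lborel_witness by blast
  from AE_lborel_translate[OF this, of "- p"] have "AE k in lborel. k \<in> B \<longleftrightarrow> p \<in> B" by simp
  then have "(AE k in lborel. k \<notin> B) \<or> (AE k in lborel. k \<notin> - B)" by (cases "p \<in> B") auto
  then show ?thesis using B by (simp add: AE_iff_null_sets)
qed

text \<open>Ergodicity of the irrational rotation without Fourier series: the period group is closed
  and contains the dense group generated by \<alpha> and 1.\<close>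

lemma rotation_invariant_null_or_conull:
  fixes B :: "real set"
  assumes B: "B \<in> sets borel" and irr: "\<alpha> \<notin> \<rat>"
    and per: "\<alpha> \<in> ae_periods B" "1 \<in> ae_periods B"
  shows "B \<in> null_sets lborel \<or> - B \<in> null_sets lborel"
proof (rule null_or_conull_of_ae_periods[OF B])
  show "ae_periods B = UNIV"
  proof (rule ccontr)
    assume "ae_periods B \<noteq> UNIV"
    then obtain x where "x \<notin> ae_periods B" by auto
    then obtain e where e: "0 < e" "\<And>y. dist y x < e \<Longrightarrow> y \<notin> ae_periods B"
      using closed_ae_periods[OF B] by (meson Compl_iff closed_open open_dist)
    obtain h k where "\<bar>of_int k * \<alpha> - of_int h - x\<bar> < e"
      using sequence_of_fractional_parts_is_dense[OF irr e(1)] by blast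
    then have "real_of_int k *\<^sub>R \<alpha> - real_of_int h *\<^sub>R 1 \<notin> ae_periods B"
      by (intro e) (simp add: dist_norm)
    then show False using ae_periods_diff ae_periods_of_int per by blast
  qed
qed

text \<open>Each vertical fibre is merely translated. This serves to undo a Birkhoff sum in the
  second coordinate, which varies with the first.\<close>

lemma emeasure_lborel_shear:
  fixes X :: "('a::euclidean_space \<times> 'b::euclidean_space) set" and g :: "'a \<Rightarrow> 'b"
  assumes X: "X \<in> sets borel" and g: "g \<in> borel_measurable borel"
  shows "emeasure lborel {p. (fst p, snd p + g (fst p)) \<in> X} = emeasure lborel X"
    and "{p. (fst p, snd p + g (fst p)) \<in> X} \<in> sets borel"
proof -
  let ?Y = "{p. (fst p, snd p + g (fst p)) \<in> X}"
  have X': "X \<in> sets (lborel \<Otimes>\<^sub>M lborel)" using X unfolding lborel_prod by simp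
  have m: "(\<lambda>p. (fst p, snd p + g (fst p))) \<in> borel_measurable (borel :: ('a \<times> 'b) measure)"
    unfolding borel_prod[symmetric] using g by measurable
  have "(\<lambda>p. (fst p, snd p + g (fst p))) -` X \<inter> space borel \<in> sets borel"
    by (rule measurable_sets[OF m X])
  then show Y: "?Y \<in> sets borel" by (simp add: vimage_def)
  then have Y': "?Y \<in> sets (lborel \<Otimes>\<^sub>M lborel)" unfolding lborel_prod by simp
  have "emeasure lborel (Pair x -` ?Y) = emeasure lborel (Pair x -` X)" for x
  proof -
    have "Pair x -` ?Y = {z. z + g x \<in> Pair x -` X}" by auto
    moreover have "Pair x -` X \<in> sets borel" using sets_Pair1[OF X'] by simp
    ultimately show ?thesis by (simp only: emeasure_lborel_translate)
  qed
  then have "emeasure (lborel \<Otimes>\<^sub>M lborel) ?Y = emeasure (lborel \<Otimes>\<^sub>M lborel) X"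
    by (simp only: lborel.emeasure_pair_measure_alt[OF X'] lborel.emeasure_pair_measure_alt[OF Y'])
  then show "emeasure lborel ?Y = emeasure lborel X" by (simp only: lborel_prod)
qed

section \<open>Jumps of Birkhoff sums\<close>

lemma periodic_of_int:
  fixes P :: "real \<Rightarrow> bool"
  assumes "\<And>x. P (x + 1) \<longleftrightarrow> P x"
  shows "P (x + of_int k) \<longleftrightarrow> P x"
proof -
  have nat: "P (x + real n) \<longleftrightarrow> P x" for x n
  proof (induction n)
    case (Suc n)
    have "P (x + real (Suc n)) \<longleftrightarrow> P (x + real n + 1)" by (simp add: algebra_simps)
    with Suc assms show ?case by simp
  qed simp
  show ?thesis
  proof (cases "0 \<le> k")
    case True
    then show ?thesis using nat[of x "nat k"] by simp
  next
    case False
    then show ?thesis using nat[of "x + of_int k" "nat (- k)"] by simp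
  qed
qed

text \<open>Cut [t, t + 1) at the integer k + 1 it contains, where k is the floor of t, and move the
  right piece back by 1: the result is [k, k + 1).\<close>

lemma emeasure_periodic_translate:
  fixes P :: "real set"
  assumes P: "P \<in> sets borel" and per: "\<And>x. x + 1 \<in> P \<longleftrightarrow> x \<in> P"
  shows "emeasure lborel {x \<in> {0..<1}. x + t \<in> P} = emeasure lborel (P \<inter> {0..<1})"
proof -
  define k where "k = real_of_int \<lfloor>t\<rfloor>"
  have k: "k \<le> t" "t < k + 1" unfolding k_def by linarith+
  have perk: "x + k \<in> P \<longleftrightarrow> x \<in> P" for x
    unfolding k_def using periodic_of_int[of "\<lambda>x. x \<in> P", OF per] .
  have disj: "emeasure lborel (P \<inter> {a..<b}) + emeasure lborel (P \<inter> {b..<c}) = emeasure lborel (P \<inter> {a..<c})"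
    if "a \<le> b" "b \<le> c" for a b c
  proof -
    have "P \<inter> {a..<b} \<union> P \<inter> {b..<c} = P \<inter> {a..<c}" using that by auto
    then show ?thesis using P by (subst plus_emeasure) auto
  qed
  have "{x \<in> {0..<1}. x + t \<in> P} = {x. x + t \<in> P \<inter> {t..<t + 1}}" by auto
  then have "emeasure lborel {x \<in> {0..<1}. x + t \<in> P} = emeasure lborel (P \<inter> {t..<t + 1})"
    using emeasure_lborel_translate[of "P \<inter> {t..<t + 1}" t] P by simp
  also have "\<dots> = emeasure lborel (P \<inter> {t..<k + 1}) + emeasure lborel (P \<inter> {k + 1..<t + 1})"
    using disj[of t "k + 1" "t + 1"] k by simp
  also have "emeasure lborel (P \<inter> {k + 1..<t + 1}) = emeasure lborel {x. x + 1 \<in> P \<inter> {k + 1..<t + 1}}"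
    using P by (subst emeasure_lborel_translate) auto
  also have "{x. x + 1 \<in> P \<inter> {k + 1..<t + 1}} = P \<inter> {k..<t}" using per by auto
  also have "emeasure lborel (P \<inter> {t..<k + 1}) + emeasure lborel (P \<inter> {k..<t}) = emeasure lborel (P \<inter> {k..<k + 1})"
    using disj[of k t "k + 1"] k by (simp add: add.commute)
  also have "\<dots> = emeasure lborel {x. x + k \<in> P \<inter> {k..<k + 1}}"
    using P by (subst emeasure_lborel_translate) auto
  also have "{x. x + k \<in> P \<inter> {k..<k + 1}} = P \<inter> {0..<1}" using perk by auto
  finally show ?thesis .
qed

text \<open>Invariance is demanded at every point of the cover, not just almost everywhere, so that
  it can be iterated along orbits and restricted to fibres.\<close>

definition skew_invariant :: "real \<Rightarrow> (real \<Rightarrow> 'b) \<Rightarrow> (real \<times> 'b::euclidean_space) set \<Rightarrow> bool" where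
  "skew_invariant \<alpha> \<Phi> B \<longleftrightarrow> B \<in> sets borel \<and> (\<forall>x y. (x + 1, y) \<in> B \<longleftrightarrow> (x, y) \<in> B) \<and>
     (\<forall>x y. (x + \<alpha>, y + \<Phi> x) \<in> B \<longleftrightarrow> (x, y) \<in> B)"

definition birkhoff :: "real \<Rightarrow> (real \<Rightarrow> 'b::real_vector) \<Rightarrow> nat \<Rightarrow> real \<Rightarrow> 'b" where
  "birkhoff \<alpha> \<Phi> q x = (\<Sum>j<q. \<Phi> (x + real j * \<alpha>))"

lemma skew_invariant_birkhoff:
  assumes "skew_invariant \<alpha> \<Phi> B"
  shows "(x + real q * \<alpha>, y + birkhoff \<alpha> \<Phi> q x) \<in> B \<longleftrightarrow> (x, y) \<in> B"
proof (induction q)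
  case (Suc q)
  have "(x + real (Suc q) * \<alpha>, y + birkhoff \<alpha> \<Phi> (Suc q) x) =
    (x + real q * \<alpha> + \<alpha>, y + birkhoff \<alpha> \<Phi> q x + \<Phi> (x + real q * \<alpha>))"
    by (simp add: birkhoff_def algebra_simps)
  with Suc assms show ?case unfolding skew_invariant_def by metis
qed (simp add: birkhoff_def)

lemma birkhoff_borel:
  fixes \<Phi> :: "real \<Rightarrow> 'b::euclidean_space"
  assumes "\<Phi> \<in> borel_measurable borel"
  shows "birkhoff \<alpha> \<Phi> q \<in> borel_measurable borel"
  unfolding birkhoff_def using assms by measurable

lemma skew_invariant_of_int:
  assumes "skew_invariant \<alpha> \<Phi> B"
  shows "(x + of_int k, y) \<in> B \<longleftrightarrow> (x, y) \<in> B"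
  using periodic_of_int[of "\<lambda>x. (x, y) \<in> B"] assms by (simp add: skew_invariant_def)

text \<open>Vertical translations commute with the skew product. Hence the set on which J fails to
  be a period is itself invariant, and if it is not null it shows up in almost every fibre.\<close>

lemma skew_invariant_mismatch:
  assumes "skew_invariant \<alpha> \<Phi> B"
  shows "skew_invariant \<alpha> \<Phi> (mismatch B (0, J))"
  unfolding skew_invariant_def
proof (intro conjI allI)
  fix x y
  have per: "(x + 1, y) \<in> B \<longleftrightarrow> (x, y) \<in> B" "(x + \<alpha>, y + \<Phi> x) \<in> B \<longleftrightarrow> (x, y) \<in> B" for x y
    using assms by (auto simp: skew_invariant_def)
  show "mismatch B (0, J) \<in> sets borel" using assms by (simp add: mismatch_borel skew_invariant_def)
  show "(x + 1, y) \<in> mismatch B (0, J) \<longleftrightarrow> (x, y) \<in> mismatch B (0, J)"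
    by (simp add: mismatch_def per)
  have "(x + \<alpha>, y + \<Phi> x + J) \<in> B \<longleftrightarrow> (x, y + J) \<in> B"
    using per(2)[of x "y + J"] by (simp add: algebra_simps)
  then show "(x + \<alpha>, y + \<Phi> x) \<in> mismatch B (0, J) \<longleftrightarrow> (x, y) \<in> mismatch B (0, J)"
    by (simp add: mismatch_def per)
qed

lemma borel_Pair_vimage:
  fixes X :: "('a::euclidean_space \<times> 'b::euclidean_space) set"
  assumes "X \<in> sets borel"
  shows "Pair x -` X \<in> sets borel"
    and "(\<lambda>x. emeasure lborel (Pair x -` X)) \<in> borel_measurable borel"
    and "emeasure lborel X = (\<integral>\<^sup>+x. emeasure lborel (Pair x -` X) \<partial>lborel)"
proof -
  have X: "X \<in> sets (lborel \<Otimes>\<^sub>M lborel)" using assms unfolding lborel_prod by simp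
  show "Pair x -` X \<in> sets borel" using sets_Pair1[OF X] by simp
  show "(\<lambda>x. emeasure lborel (Pair x -` X)) \<in> borel_measurable borel"
    using lborel.measurable_emeasure_Pair[OF X] by simp
  show "emeasure lborel X = (\<integral>\<^sup>+x. emeasure lborel (Pair x -` X) \<partial>lborel)"
    using lborel.emeasure_pair_measure_alt[OF X] by (simp only: lborel_prod)
qed

text \<open>Fibres over x and x + \<alpha> are translates of each other, so having a null fibre is a
  rotation-invariant property of x.\<close>

lemma skew_invariant_fibres:
  fixes D :: "(real \<times> 'b::euclidean_space) set"
  assumes D: "skew_invariant \<alpha> \<Phi> D" and irr: "\<alpha> \<notin> \<rat>"
  shows "emeasure lborel D = 0 \<or> (AE x in lborel. emeasure lborel (Pair x -` D) \<noteq> 0)"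
proof -
  have Db: "D \<in> sets borel" using D by (simp add: skew_invariant_def)
  note bP = borel_Pair_vimage[OF Db]
  define E where "E = {x. emeasure lborel (Pair x -` D) \<noteq> 0}"
  have "{x \<in> space borel. emeasure lborel (Pair x -` D) \<noteq> 0} \<in> sets borel"
    using bP(2) by measurable
  then have E: "E \<in> sets borel" by (simp add: E_def)
  have "Pair (x + 1) -` D = Pair x -` D" for x using D by (auto simp: skew_invariant_def)
  then have one: "1 \<in> ae_periods E" by (auto simp: ae_periods_def E_def)
  have "emeasure lborel (Pair (x + \<alpha>) -` D) = emeasure lborel (Pair x -` D)" for x
  proof -
    have "Pair x -` D = {y. y + \<Phi> x \<in> Pair (x + \<alpha>) -` D}" using D by (auto simp: skew_invariant_def)
    then show ?thesis using emeasure_lborel_translate[OF bP(1)[of "x + \<alpha>"], of "\<Phi> x"] by simp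
  qed
  then have "\<alpha> \<in> ae_periods E" by (auto simp: ae_periods_def E_def)
  from rotation_invariant_null_or_conull[OF E irr this one]
  consider "AE x in lborel. x \<notin> E" | "AE x in lborel. x \<notin> - E"
    using E by (auto simp: AE_iff_null_sets)
  then show ?thesis
  proof cases
    case 1
    then have "AE x in lborel. emeasure lborel (Pair x -` D) = 0" by (simp add: E_def)
    then have "emeasure lborel D = 0" using bP(2,3) by (subst bP(3)) (simp add: nn_integral_0_iff_AE)
    then show ?thesis ..
  next
    case 2
    then show ?thesis by (simp add: E_def)
  qed
qed

text \<open>For \<open>x \<in> E\<close> the invariance of \<open>B\<close> relates the membership of \<open>(x + s, y)\<close> and \<open>(x, y)\<close>
  in \<open>B\<close> to that of two points whose second coordinates differ by \<open>J\<close>, and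
  translating by the small amount \<open>s\<close> hardly changes \<open>B\<close>.\<close>

lemma jump_is_period:
  fixes \<Phi> :: "real \<Rightarrow> 'b::euclidean_space"
  assumes irr: "\<alpha> \<notin> \<rat>" and \<Phi>: "\<Phi> \<in> borel_measurable borel" and \<delta>: "0 < \<delta>" and R0: "0 \<le> R0"
    and jumps: "\<And>\<eta>. 0 < \<eta> \<Longrightarrow> \<exists>q s E. \<bar>s\<bar> < \<eta> \<and> E \<in> sets borel \<and> E \<subseteq> {0..<1} \<and>
      ennreal \<delta> \<le> emeasure lborel E \<and>
      (\<forall>x\<in>E. norm (birkhoff \<alpha> \<Phi> q x) \<le> R0 \<and> birkhoff \<alpha> \<Phi> q (x + s) = birkhoff \<alpha> \<Phi> q x + J)"
    and B: "skew_invariant \<alpha> \<Phi> B"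
  shows "(0, J) \<in> ae_periods B"
proof -
  define D where "D = mismatch B (0, J)"
  have Bb: "B \<in> sets borel" using B by (simp add: skew_invariant_def)
  have D: "skew_invariant \<alpha> \<Phi> D" unfolding D_def by (rule skew_invariant_mismatch[OF B])
  have Db: "D \<in> sets borel" using D by (simp add: skew_invariant_def)
  have "emeasure lborel D = 0"
  proof (rule ccontr)
    assume "emeasure lborel D \<noteq> 0"
    then have full: "AE x in lborel. emeasure lborel (Pair x -` D) \<noteq> 0"
      using skew_invariant_fibres[OF D irr] by blast
    \<comment> \<open>The shift estimate holds only on bounded sets, so D is truncated
      vertically.\<close>
    define Dn where "Dn n = D \<inter> UNIV \<times> cball 0 (real n)" for n :: nat
    have cyl: "UNIV \<times> cball (0::'b) r \<in> sets borel" for r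
      by (intro borel_closed closed_Times) auto
    have Dnb: "Dn n \<in> sets borel" for n using Db cyl unfolding Dn_def by blast
    define g where "g n x = emeasure lborel (Pair x -` Dn n)" for n x
    have gb: "g n \<in> borel_measurable borel" for n
      unfolding g_def by (rule borel_Pair_vimage(2)[OF Dnb])
    have mono: "g m x \<le> g n x" if "m \<le> n" for m n x
      unfolding g_def using that borel_Pair_vimage(1)[OF Dnb] by (intro emeasure_mono) (auto simp: Dn_def)
    \<comment> \<open>The base points with too thin a truncated fibre. These sets decrease, since
      the fibres grow with n while the threshold falls, and their intersection is null on the unit
      interval because almost every fibre of D has positive measure.\<close>
    define G where "G n = {x. g n x \<le> ennreal (1 / real (Suc n))}" for n
    have Gb: "G n \<in> sets borel" for n
    proof -
      have "{x \<in> space borel. g n x \<le> ennreal (1 / real (Suc n))} \<in> sets borel" using gb by measurable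
      then show ?thesis by (simp add: G_def)
    qed
    have Gper: "x + 1 \<in> G n \<longleftrightarrow> x \<in> G n" for x n
    proof -
      have "Pair (x + 1) -` Dn n = Pair x -` Dn n" using D by (auto simp: skew_invariant_def Dn_def)
      then show ?thesis by (simp add: G_def g_def)
    qed
    have "(\<lambda>n. emeasure lborel (G n \<inter> {0..<1})) \<longlonglongrightarrow> emeasure lborel (\<Inter>n. G n \<inter> {0..<1})"
    proof (rule Lim_emeasure_decseq)
      show "range (\<lambda>n. G n \<inter> {0..<1}) \<subseteq> sets lborel" using Gb by auto
      show "decseq (\<lambda>n. G n \<inter> {0..<1})"
      proof (rule decseq_SucI)
        fix n
        have "x \<in> G n" if "x \<in> G (Suc n)" for x
        proof -
          have "g n x \<le> g (Suc n) x" by (rule mono) simp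
          also have "\<dots> \<le> ennreal (1 / real (Suc (Suc n)))" using that by (simp add: G_def)
          also have "\<dots> \<le> ennreal (1 / real (Suc n))" by (intro ennreal_leI divide_left_mono) auto
          finally show ?thesis by (simp add: G_def)
        qed
        then show "G (Suc n) \<inter> {0..<1} \<subseteq> G n \<inter> {0..<1}" by auto
      qed
      show "emeasure lborel (G n \<inter> {0..<1}) \<noteq> \<infinity>" for n
        using emeasure_bounded_finite[of "G n \<inter> {0..<1}"] by (auto simp: bounded_subset[of "{0..<1}"])
    qed
    also have "emeasure lborel (\<Inter>n. G n \<inter> {0..<1}) = 0"
    proof -
      have zero: "emeasure lborel (Pair x -` D) = 0" if x: "\<And>n. x \<in> G n" for x
      proof -
        have "g m x = 0" for m
        proof -
          have "g m x \<le> 0"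
          proof (rule tendsto_lowerbound)
            show "(\<lambda>n. ennreal (1 / real (Suc n))) \<longlonglongrightarrow> 0"
              using tendsto_ennrealI[OF LIMSEQ_inverse_real_of_nat] by (simp add: inverse_eq_divide)
            show "\<forall>\<^sub>F n in sequentially. g m x \<le> ennreal (1 / real (Suc n))"
              unfolding eventually_sequentially
            proof (intro exI[of _ m] allI impI)
              fix n assume "m \<le> n"
              from mono[OF this, of x] x[of n] show "g m x \<le> ennreal (1 / real (Suc n))" by (simp add: G_def)
            qed
          qed simp
          then show ?thesis by simp
        qed
        then have "(\<Union>n. Pair x -` Dn n) \<in> null_sets lborel"
          using borel_Pair_vimage(1)[OF Dnb] by (intro null_sets_UN) (auto simp: g_def null_sets_def)
        moreover have "(\<Union>n. Pair x -` Dn n) = Pair x -` D"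
          by (auto simp: Dn_def intro: real_arch_simple)
        ultimately show ?thesis by (simp add: null_sets_def)
      qed
      have "AE x in lborel. x \<notin> (\<Inter>n. G n \<inter> {0..<1})"
        using full by eventually_elim (use zero in blast)
      moreover have "(\<Inter>n. G n \<inter> {0..<1}) \<in> sets lborel" using Gb by auto
      ultimately have "(\<Inter>n. G n \<inter> {0..<1}) \<in> null_sets lborel" by (subst AE_iff_null_sets)
      then show ?thesis by (rule null_setsD1)
    qed
    finally have "\<forall>\<^sub>F n in sequentially. emeasure lborel (G n \<inter> {0..<1}) < ennreal (\<delta> / 2)"
      using \<delta> by (intro order_tendstoD(2)) auto
    then obtain n where n: "emeasure lborel (G n \<inter> {0..<1}) < ennreal (\<delta> / 2)"
      by (auto simp: eventually_sequentially)
    define \<kappa> where "\<kappa> = 1 / real (Suc n)"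
    \<comment> \<open>Two sets of measure at most \<epsilon> will cover a set W of measure at least
      \<kappa> \<delta> / 2, and 2 \<epsilon> is only \<kappa> \<delta> / 4.\<close>
    define \<epsilon> where "\<epsilon> = \<kappa> * \<delta> / 8"
    have pos: "0 < \<kappa>" "0 < \<epsilon>" using \<delta> by (auto simp: \<kappa>_def \<epsilon>_def)
    \<comment> \<open>The ball has to contain (x, y) with \<bar>x\<bar> <= 1 and norm y <= R0 + n,
      and (x + t, z) with x + t < 2 and norm z <= n. For the second bound q \<alpha> is reduced
      modulo 1 to t.\<close>
    define R where "R = R0 + real n + 2"
    obtain d where d: "0 < d" "\<And>v. norm v < d \<Longrightarrow> emeasure lborel (mismatch B v \<inter> cball 0 R) \<le> ennreal \<epsilon>"
      using mismatch_tendsto_zero[OF Bb pos(2), of R] by blast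
    obtain q s E where s: "\<bar>s\<bar> < d" and E: "E \<in> sets borel" "E \<subseteq> {0..<1}" "ennreal \<delta> \<le> emeasure lborel E"
      and bound: "\<And>x. x \<in> E \<Longrightarrow> norm (birkhoff \<alpha> \<Phi> q x) \<le> R0"
      and jump: "\<And>x. x \<in> E \<Longrightarrow> birkhoff \<alpha> \<Phi> q (x + s) = birkhoff \<alpha> \<Phi> q x + J"
      using jumps[OF d(1)] by metis
    define Y where "Y = mismatch B (s, 0) \<inter> cball 0 R"
    have Yb: "Y \<in> sets borel" using mismatch_borel[OF Bb] by (auto simp: Y_def)
    have Ye: "emeasure lborel Y \<le> ennreal \<epsilon>" unfolding Y_def using s by (intro d) (simp add: norm_Pair)
    define \<tau> where "\<tau> = s + real q * \<alpha>"
    define W where "W = {p. p + (\<tau>, 0) \<in> Dn n} \<inter> E \<times> UNIV"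
    have EU: "E \<times> UNIV \<in> sets (borel :: (real \<times> 'b) measure)"
      unfolding borel_prod[symmetric] using E by auto
    have Wb: "W \<in> sets borel" unfolding W_def
      using borel_vimage_translate[OF Dnb, of "(\<tau>, 0)" n] EU by (rule sets.Int)
    define M1 where "M1 = {p. (fst p, snd p + - birkhoff \<alpha> \<Phi> q (fst p)) \<in> Y}"
    define t where "t = frac (real q * \<alpha>)"
    define M2 where "M2 = {p. p + (t, 0) \<in> Y}"
    have mb: "(\<lambda>x. - birkhoff \<alpha> \<Phi> q x) \<in> borel_measurable borel"
      using birkhoff_borel[OF \<Phi>] by (intro borel_measurable_uminus)
    have M1: "M1 \<in> sets borel" "emeasure lborel M1 \<le> ennreal \<epsilon>"
      using emeasure_lborel_shear[OF Yb mb] Ye by (simp_all add: M1_def)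
    have M2: "M2 \<in> sets borel" "emeasure lborel M2 \<le> ennreal \<epsilon>"
      using emeasure_lborel_translate[OF Yb] borel_vimage_translate[OF Yb] Ye by (simp_all add: M2_def)
    \<comment> \<open>With y = z minus the Birkhoff sum at x, invariance links (x, y) to (x + q
      \<alpha>, z) and (x + s, y) to (x + \<tau>, z + J). As (x + \<tau>, z) and (x + \<tau>, z + J)
      disagree about B, the shift by s must change membership at (x, y), which is \<open>M1\<close>,
      or at (x + t, z), which is \<open>M2\<close>.\<close>
    have "W \<subseteq> M1 \<union> M2"
    proof
      fix p assume pW: "p \<in> W"
      obtain x z where p: "p = (x, z)" by fastforce
      have x: "x \<in> E" "0 \<le> x" "x < 1" and z: "norm z \<le> real n" and xz: "(x + \<tau>, z) \<in> D"
        using pW E by (auto simp: W_def Dn_def p)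
      define y where "y = z - birkhoff \<alpha> \<Phi> q x"
      have nx: "\<bar>x\<bar> \<le> 1" using x by simp
      have ny: "norm y \<le> R0 + real n" using bound[OF x(1)] z norm_triangle_ineq4[of z "birkhoff \<alpha> \<Phi> q x"]
        by (simp add: y_def)
      have D1: "(x + \<tau>, z + J) \<in> B \<longleftrightarrow> (x + \<tau>, z) \<notin> B" using xz by (auto simp: D_def mismatch_def)
      have "(x + s + real q * \<alpha>, y + birkhoff \<alpha> \<Phi> q (x + s)) \<in> B \<longleftrightarrow> (x + s, y) \<in> B"
        by (rule skew_invariant_birkhoff[OF B])
      then have D2: "(x + \<tau>, z + J) \<in> B \<longleftrightarrow> (x + s, y) \<in> B"
        by (simp add: jump[OF x(1)] y_def \<tau>_def add.assoc)
      have "(x + real q * \<alpha>, y + birkhoff \<alpha> \<Phi> q x) \<in> B \<longleftrightarrow> (x, y) \<in> B"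
        by (rule skew_invariant_birkhoff[OF B])
      then have D3: "(x + real q * \<alpha>, z) \<in> B \<longleftrightarrow> (x, y) \<in> B" by (simp add: y_def)
      have shift: "(u + t, z) \<in> B \<longleftrightarrow> (u + real q * \<alpha>, z) \<in> B" for u
        using skew_invariant_of_int[OF B, of "u + t" "\<lfloor>real q * \<alpha>\<rfloor>" z]
        by (simp add: t_def frac_def)
      have D4: "(x + t, z) \<in> B \<longleftrightarrow> (x, y) \<in> B" using shift[of x] D3 by simp
      have D5: "(x + t + s, z) \<in> B \<longleftrightarrow> (x + \<tau>, z) \<in> B"
        using shift[of "x + s"] by (simp add: \<tau>_def algebra_simps)
      have t: "0 \<le> t" "t < 1" by (auto simp: t_def frac_lt_1)
      have "norm (x, y) \<le> R" using norm_Pair_le[of x y] nx ny by (simp add: R_def)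
      moreover have "norm (x + t, z) \<le> R" using norm_Pair_le[of "x + t" z] x t z R0 by (simp add: R_def)
      ultimately show "p \<in> M1 \<union> M2"
        using D1 D2 D4 D5 by (auto simp: p M1_def M2_def Y_def mismatch_def y_def)
    qed
    then have "emeasure lborel W \<le> emeasure lborel (M1 \<union> M2)" using M1 M2 by (intro emeasure_mono) auto
    also have "\<dots> \<le> emeasure lborel M1 + emeasure lborel M2" using M1 M2 by (intro emeasure_subadditive) auto
    also have "\<dots> \<le> ennreal \<epsilon> + ennreal \<epsilon>" using M1 M2 by (intro add_mono)
    also have "\<dots> = ennreal (2 * \<epsilon>)" using pos by (simp add: ennreal_plus[symmetric] del: ennreal_plus)
    finally have upper: "emeasure lborel W \<le> ennreal (2 * \<epsilon>)" .
    \<comment> \<open>By periodicity, discarding the points that \<tau> moves into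
      \<open>G n\<close> costs less than \<delta> / 2. Over the rest the fibres of W have measure at
      least \<kappa>.\<close>
    define F where "F = E - {x \<in> {0..<1}. x + \<tau> \<in> G n}"
    have Gt: "{x \<in> {0..<1}. x + \<tau> \<in> G n} \<in> sets borel"
    proof -
      have "{0..<1} \<inter> {x. x + \<tau> \<in> G n} \<in> sets borel" using borel_vimage_translate[OF Gb] by auto
      then show ?thesis by (simp add: Int_def)
    qed
    have Fb: "F \<in> sets borel" unfolding F_def using E Gt by auto
    have "emeasure lborel F < \<infinity>" using E by (intro emeasure_bounded_finite) (auto simp: F_def intro: bounded_subset[of "{0..<1::real}"])
    then obtain a where a: "emeasure lborel F = ennreal a" "0 \<le> a" by (cases "emeasure lborel F") auto
    have "ennreal \<delta> \<le> emeasure lborel (F \<union> {x \<in> {0..<1}. x + \<tau> \<in> G n})"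
      using E(3) by (rule order_trans) (use E Gt in \<open>auto intro!: emeasure_mono simp: F_def\<close>)
    also have "\<dots> \<le> emeasure lborel F + emeasure lborel {x \<in> {0..<1}. x + \<tau> \<in> G n}"
      using Fb Gt by (intro emeasure_subadditive) auto
    also have "emeasure lborel {x \<in> {0..<1}. x + \<tau> \<in> G n} = emeasure lborel (G n \<inter> {0..<1})"
      by (rule emeasure_periodic_translate[OF Gb Gper])
    also have "emeasure lborel F + emeasure lborel (G n \<inter> {0..<1}) \<le> ennreal a + ennreal (\<delta> / 2)"
      using n a by (intro add_mono) auto
    finally have "ennreal \<delta> \<le> ennreal (a + \<delta> / 2)" using a \<delta> by simp
    then have a2: "\<delta> / 2 \<le> a" using a \<delta> by (subst (asm) ennreal_le_iff) auto
    have "ennreal (\<kappa> * (\<delta> / 2)) \<le> ennreal (\<kappa> * a)" using a2 pos by (intro ennreal_leI mult_left_mono) auto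
    also have "\<dots> = ennreal \<kappa> * emeasure lborel F" using a pos by (simp add: ennreal_mult)
    also have "\<dots> = (\<integral>\<^sup>+x. ennreal \<kappa> * indicator F x \<partial>lborel)" using Fb by (simp add: nn_integral_cmult_indicator)
    also have "\<dots> \<le> (\<integral>\<^sup>+x. emeasure lborel (Pair x -` W) \<partial>lborel)"
    proof (intro nn_integral_mono)
      fix x :: real
      show "ennreal \<kappa> * indicator F x \<le> emeasure lborel (Pair x -` W)"
      proof (cases "x \<in> F")
        case True
        then have "x \<in> E" "x + \<tau> \<notin> G n" using E by (auto simp: F_def)
        then have "ennreal \<kappa> \<le> g n (x + \<tau>)" by (simp add: G_def \<kappa>_def)
        also have "\<dots> = emeasure lborel (Pair x -` W)"
          unfolding g_def using \<open>x \<in> E\<close> by (intro arg_cong[where f = "emeasure lborel"]) (auto simp: W_def)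
        finally show ?thesis using True by simp
      qed simp
    qed
    also have "\<dots> = emeasure lborel W" by (rule borel_Pair_vimage(3)[OF Wb, symmetric])
    also note upper
    finally have "\<kappa> * (\<delta> / 2) \<le> 2 * \<epsilon>" using pos by (simp add: ennreal_le_iff)
    then show False using pos \<delta> by (simp add: \<epsilon>_def)
  qed
  then have "D \<in> null_sets lborel" using Db by (simp add: null_sets_def)
  then have "AE p in lborel. p \<notin> D" by (rule AE_not_in)
  then show ?thesis by (auto simp: ae_periods_def D_def mismatch_def)
qed

text \<open>A piecewise constant function with jump \<open>J i\<close> at the points of
  \<open>e i\<close> + Z; it is 1-periodic when the jumps sum to 0.\<close>

definition step_cocycle :: "'i set \<Rightarrow> ('i \<Rightarrow> 'b::real_vector) \<Rightarrow> ('i \<Rightarrow> real) \<Rightarrow> real \<Rightarrow> 'b" where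
  "step_cocycle I J e x = (\<Sum>i\<in>I. (of_int \<lfloor>x - e i\<rfloor> + e i) *\<^sub>R J i)"

lemma birkhoff_step_cocycle:
  "birkhoff \<alpha> (step_cocycle I J e) q x =
    (\<Sum>i\<in>I. (of_int (\<Sum>j<q. \<lfloor>x - e i + real j * \<alpha>\<rfloor>) + real q * e i) *\<^sub>R J i)"
proof -
  have "birkhoff \<alpha> (step_cocycle I J e) q x =
    (\<Sum>i\<in>I. \<Sum>j<q. (of_int \<lfloor>x + real j * \<alpha> - e i\<rfloor> + e i) *\<^sub>R J i)"
    unfolding birkhoff_def step_cocycle_def by (rule sum.swap)
  also have "\<dots> = (\<Sum>i\<in>I. (\<Sum>j<q. of_int \<lfloor>x - e i + real j * \<alpha>\<rfloor> + e i) *\<^sub>R J i)"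
    by (simp only: scaleR_sum_left) (simp add: algebra_simps)
  finally show ?thesis by (simp add: sum.distrib)
qed

text \<open>Each floor sum is q (x - \<open>e i\<close>) + S up to an error of 2, with the same S
  for all i. The centring removes q \<open>e i\<close>, and the common term q x + S disappears
  because the jumps sum to 0.\<close>

lemma birkhoff_step_cocycle_bound:
  fixes J :: "'i \<Rightarrow> 'b::real_normed_vector"
  assumes q: "0 < q" and cop: "coprime p (int q)" and approx: "\<bar>real q * \<alpha> - real_of_int p\<bar> \<le> 1 / q"
    and J: "sum J I = 0"
  shows "norm (birkhoff \<alpha> (step_cocycle I J e) q x) \<le> 2 * (\<Sum>i\<in>I. norm (J i))"
proof -
  obtain S :: int where S: "\<And>x. \<bar>real_of_int (\<Sum>j<q. \<lfloor>x + real j * \<alpha>\<rfloor>) - (real q * x + real_of_int S)\<bar> \<le> 2"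
    using sum_floor_orbit[OF q cop approx] by blast
  define \<theta> where "\<theta> i = real_of_int (\<Sum>j<q. \<lfloor>x - e i + real j * \<alpha>\<rfloor>) - (real q * (x - e i) + real_of_int S)" for i
  have "birkhoff \<alpha> (step_cocycle I J e) q x = (\<Sum>i\<in>I. (real q * x + S + \<theta> i) *\<^sub>R J i)"
    unfolding birkhoff_step_cocycle by (intro sum.cong refl) (simp add: \<theta>_def algebra_simps)
  also have "\<dots> = (real q * x + S) *\<^sub>R sum J I + (\<Sum>i\<in>I. \<theta> i *\<^sub>R J i)"
    by (simp add: scaleR_add_left sum.distrib scaleR_sum_right)
  also have "\<dots> = (\<Sum>i\<in>I. \<theta> i *\<^sub>R J i)" using J by simp
  finally have "norm (birkhoff \<alpha> (step_cocycle I J e) q x) \<le> (\<Sum>i\<in>I. norm (\<theta> i *\<^sub>R J i))"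
    by (simp only: norm_sum)
  also have "\<dots> \<le> (\<Sum>i\<in>I. 2 * norm (J i))"
    using S by (intro sum_mono) (auto simp: \<theta>_def intro!: mult_right_mono)
  finally show ?thesis by (simp add: sum_distrib_left)
qed

lemma step_cocycle_borel:
  fixes J :: "'i \<Rightarrow> 'b::euclidean_space"
  shows "step_cocycle I J e \<in> borel_measurable borel"
  unfolding step_cocycle_def by measurable

lemma frac_add_ge_one:
  fixes w s :: real
  assumes "1 - s \<le> frac w" "0 < s" "s < 1"
  shows "\<lfloor>w + s\<rfloor> = \<lfloor>w\<rfloor> + 1"
  using assms frac_lt_1[of w] by (intro floor_unique) (auto simp: frac_def)

text \<open>The shift by s takes x across the discontinuity \<open>e i0\<close> - j \<alpha>.
  Crossing a second one would put the two within s of each other modulo 1, although separation, or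
  \<open>self\<close> when both come from \<open>i0\<close>, keeps them at least 2 s apart.\<close>

lemma isolated_jump:
  fixes J :: "'i \<Rightarrow> 'b::real_vector"
  assumes fin: "finite I" and i0: "i0 \<in> I" and qM: "q \<le> M" and s: "0 < s" "s < 1" "2 * s \<le> \<epsilon> / M"
    and sep: "\<And>i. i \<in> I \<Longrightarrow> i \<noteq> i0 \<Longrightarrow> separated \<alpha> \<epsilon> M (e i0 - e i)"
    and self: "\<And>k z :: int. k \<noteq> 0 \<Longrightarrow> \<bar>k\<bar> \<le> int M \<Longrightarrow> \<epsilon> / M \<le> \<bar>real_of_int k * \<alpha> - real_of_int z\<bar>"
    and j: "j < q" "1 - s \<le> frac (x - e i0 + real j * \<alpha>)"
  shows "\<And>i j'. i \<in> I \<Longrightarrow> j' < q \<Longrightarrow>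
      \<lfloor>x + s - e i + real j' * \<alpha>\<rfloor> = \<lfloor>x - e i + real j' * \<alpha>\<rfloor> + (if i = i0 \<and> j' = j then 1 else 0)"
    and "birkhoff \<alpha> (step_cocycle I J e) q (x + s) = birkhoff \<alpha> (step_cocycle I J e) q x + J i0"
proof -
  define w where "w = x - e i0 + real j * \<alpha>"
  have f: "1 - s \<le> frac w" using j by (simp add: w_def)
  show *: "\<lfloor>x + s - e i + real j' * \<alpha>\<rfloor> = \<lfloor>x - e i + real j' * \<alpha>\<rfloor> + (if i = i0 \<and> j' = j then 1 else 0)"
    if i: "i \<in> I" and j': "j' < q" for i j'
  proof (cases "i = i0 \<and> j' = j")
    case True
    then show ?thesis using frac_add_ge_one[OF f s(1,2)] by (simp add: w_def algebra_simps)
  next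
    case False
    define w' where "w' = x - e i + real j' * \<alpha>"
    define k where "k = int j - int j'"
    have k: "\<bar>k\<bar> \<le> int M" using j j' qM by (simp add: k_def)
    have far: "\<epsilon> / M \<le> \<bar>(e i0 - e i) - real_of_int k * \<alpha> - real_of_int z\<bar>" for z :: int
    proof (cases "i = i0")
      case True
      with False have "k \<noteq> 0" by (simp add: k_def)
      from self[OF this k, of "- z"] True show ?thesis by simp
    next
      case False
      then show ?thesis using sep[OF i] k unfolding separated_def by blast
    qed
    have "\<lfloor>w' + s\<rfloor> = \<lfloor>w'\<rfloor>"
    proof (rule ccontr)
      assume ne: "\<lfloor>w' + s\<rfloor> \<noteq> \<lfloor>w'\<rfloor>"
      define z where "z = \<lfloor>w' + s\<rfloor>"
      have "\<lfloor>w'\<rfloor> < z" using ne s floor_mono[of w' "w' + s"] by (simp add: z_def)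
      then have z: "w' < z" "z \<le> w' + s" unfolding z_def by linarith+
      have "w' = w + ((e i0 - e i) - real_of_int k * \<alpha>)"
        by (simp add: w_def w'_def k_def algebra_simps)
      moreover have "w = \<lfloor>w\<rfloor> + frac w" "frac w < 1" by (simp_all add: frac_def frac_lt_1) linarith
      ultimately have "\<bar>(e i0 - e i) - real_of_int k * \<alpha> - real_of_int (z - \<lfloor>w\<rfloor> - 1)\<bar> \<le> s"
        using z f by (simp add: abs_le_iff)
      with far[of "z - \<lfloor>w\<rfloor> - 1"] s show False by linarith
    qed
    with False show ?thesis by (simp add: w'_def algebra_simps)
  qed
  have "(\<Sum>j'<q. \<lfloor>x + s - e i + real j' * \<alpha>\<rfloor>) = (\<Sum>j'<q. \<lfloor>x - e i + real j' * \<alpha>\<rfloor>) + (if i = i0 then 1 else 0)"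
    if i: "i \<in> I" for i
  proof -
    have "(\<Sum>j'<q. \<lfloor>x + s - e i + real j' * \<alpha>\<rfloor>) =
      (\<Sum>j'<q. \<lfloor>x - e i + real j' * \<alpha>\<rfloor> + (if i = i0 \<and> j' = j then 1 else 0))"
      using *[OF i] by (intro sum.cong) auto
    also have "\<dots> = (\<Sum>j'<q. \<lfloor>x - e i + real j' * \<alpha>\<rfloor>) + (if i = i0 then (\<Sum>j'<q. if j' = j then 1 else 0) else 0)"
      by (simp add: sum.distrib)
    finally show ?thesis using j by simp
  qed
  then have "birkhoff \<alpha> (step_cocycle I J e) q (x + s) =
    (\<Sum>i\<in>I. (of_int (\<Sum>j<q. \<lfloor>x - e i + real j * \<alpha>\<rfloor>) + real q * e i) *\<^sub>R J i + (if i = i0 then J i0 else 0))"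
    unfolding birkhoff_step_cocycle by (intro sum.cong refl) (auto simp: scaleR_add_left)
  also have "\<dots> = birkhoff \<alpha> (step_cocycle I J e) q x + J i0"
    unfolding birkhoff_step_cocycle using fin i0 by (simp add: sum.distrib)
  finally show "birkhoff \<alpha> (step_cocycle I J e) q (x + s) = birkhoff \<alpha> (step_cocycle I J e) q x + J i0" .
qed

text \<open>At scale M, Dirichlet gives q <= M with an error below 1 / M, and bad approximability
  forces q > c M. The sets \<open>E j\<close> of points just before one of the q jumps of
  \<open>i0\<close> have measure s = \<epsilon> / (2 M) each, so their union has measure at least c
  \<epsilon> / 2 at every scale.\<close>

lemma isolated_jump_is_period:
  fixes J :: "'i \<Rightarrow> 'b::euclidean_space"
  assumes bad: "badly_approximable c \<alpha>" and fin: "finite I" and J: "sum J I = 0" and i0: "i0 \<in> I"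
    and \<epsilon>: "0 < \<epsilon>" "\<epsilon> \<le> c"
    and sep: "\<And>N0. \<exists>M\<ge>N0. \<forall>i\<in>I - {i0}. separated \<alpha> \<epsilon> M (e i0 - e i)"
    and B: "skew_invariant \<alpha> (step_cocycle I J e) B"
  shows "(0, J i0) \<in> ae_periods B"
proof (rule jump_is_period[OF badly_approximable_irrational[OF bad] step_cocycle_borel _ _ _ B])
  have c: "0 < c" using bad by (simp add: badly_approximable_def)
  show "0 < c * \<epsilon> / 2" using c \<epsilon> by simp
  show "0 \<le> 2 * (\<Sum>i\<in>I. norm (J i))" by (simp add: sum_nonneg)
  fix \<eta> :: real assume \<eta>: "0 < \<eta>"
  obtain N0 :: nat where N0: "\<epsilon> / min \<eta> 1 < N0" using reals_Archimedean2 by blast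
  obtain M where M: "max 1 N0 \<le> M" and sepM: "\<forall>i\<in>I - {i0}. separated \<alpha> \<epsilon> M (e i0 - e i)"
    using sep by blast
  have M0: "0 < real M" using M by simp
  define s where "s = \<epsilon> / (2 * M)"
  have s0: "0 < s" using \<epsilon> M0 by (simp add: s_def)
  have "s < min \<eta> 1"
  proof -
    define m where "m = min \<eta> 1"
    have "0 < m" "\<epsilon> / m < real M" using \<eta> N0 M by (auto simp: m_def)
    then have "\<epsilon> / real M < m" using M0 by (simp add: divide_less_eq mult.commute)
    then have "s < m" using s0 by (simp add: s_def)
    then show ?thesis by (simp add: m_def)
  qed
  then have s: "s < \<eta>" "s < 1" by auto
  obtain p k where pk: "coprime p k" "0 < k" "k \<le> int M" "\<bar>of_int k * \<alpha> - of_int p\<bar> < 1 / M"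
    using Dirichlet_approx_coprime[of M \<alpha>] M by auto
  define q where "q = nat k"
  have q: "0 < q" "q \<le> M" "coprime p (int q)" "\<bar>real q * \<alpha> - real_of_int p\<bar> < 1 / M"
    using pk by (auto simp: q_def)
  have approx: "\<bar>real q * \<alpha> - real_of_int p\<bar> \<le> 1 / q"
  proof -
    have "1 / real M \<le> 1 / real q" using q by (intro divide_left_mono) auto
    with q(4) show ?thesis by linarith
  qed
  have "c / \<bar>real_of_int (int q)\<bar> \<le> \<bar>real_of_int (int q) * \<alpha> - real_of_int p\<bar>"
    using bad q(1) unfolding badly_approximable_def by (metis of_nat_0_less_iff less_irrefl)
  then have "c / q < 1 / M" using q(4) by simp
  then have qc: "c * M < q" using q M0 by (simp add: field_simps)
  have self: "\<epsilon> / M \<le> \<bar>real_of_int k * \<alpha> - real_of_int z\<bar>" if "k \<noteq> 0" "\<bar>k\<bar> \<le> int M" for k z :: int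
  proof -
    have "\<epsilon> / M \<le> c / \<bar>real_of_int k\<bar>" using that \<epsilon> c by (intro frac_le) auto
    also have "\<dots> \<le> \<bar>real_of_int k * \<alpha> - real_of_int z\<bar>"
      using bad that unfolding badly_approximable_def by blast
    finally show ?thesis .
  qed
  define P where "P = {x :: real. 1 - s \<le> frac x}"
  define E where "E j = {x \<in> {0..<1}. x + (real j * \<alpha> - e i0) \<in> P}" for j :: nat
  have "{x \<in> space borel. 1 - s \<le> frac x} \<in> sets borel" unfolding frac_def by measurable
  then have Pb: "P \<in> sets borel" by (simp add: P_def)
  have Pper: "x + 1 \<in> P \<longleftrightarrow> x \<in> P" for x by (simp add: P_def frac_1_eq)
  have Eb: "E j \<in> sets borel" for j
  proof -
    have "E j = {0..<1} \<inter> {x. x + (real j * \<alpha> - e i0) \<in> P}" by (auto simp: E_def)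
    then show ?thesis using borel_vimage_translate[OF Pb] by auto
  qed
  have Em: "emeasure lborel (E j) = ennreal s" for j
  proof -
    have "emeasure lborel (E j) = emeasure lborel (P \<inter> {0..<1})"
      unfolding E_def by (rule emeasure_periodic_translate[OF Pb Pper])
    also have "P \<inter> {0..<1} = {1 - s..<1}" using s0 s by (auto simp: P_def frac_eq[THEN iffD2])
    finally show ?thesis using s0 by simp
  qed
  have s2: "2 * s \<le> \<epsilon> / M" by (simp add: s_def)
  have mem: "1 - s \<le> frac (x - e i0 + real j * \<alpha>)" if "x \<in> E j" for x j
    using that by (simp add: E_def P_def algebra_simps)
  have sepM': "\<And>i. i \<in> I \<Longrightarrow> i \<noteq> i0 \<Longrightarrow> separated \<alpha> \<epsilon> M (e i0 - e i)" using sepM by blast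
  note iso = isolated_jump[where e = e and \<alpha> = \<alpha> and \<epsilon> = \<epsilon>, OF fin i0 q(2) s0 s(2) s2 sepM' self _ mem]
  have disj: "disjoint_family_on E {..<q}"
    unfolding disjoint_family_on_def
  proof (intro ballI impI, rule ccontr)
    \<comment> \<open>For a common point the floor with index n would both stay fixed, as m differs
      from n, and grow by 1.\<close>
    fix m n assume mn: "m \<in> {..<q}" "n \<in> {..<q}" "m \<noteq> n" and "E m \<inter> E n \<noteq> {}"
    then obtain x where "x \<in> E m" "x \<in> E n" by auto
    with iso(1)[of m x i0 n] iso(1)[of n x i0 n] mn i0 show False by simp
  qed
  define EE where "EE = (\<Union>j<q. E j)"
  have EEb: "EE \<in> sets borel" using Eb by (auto simp: EE_def)
  have "emeasure lborel EE = (\<Sum>j<q. emeasure lborel (E j))"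
    unfolding EE_def using Eb disj by (intro sum_emeasure[symmetric]) auto
  also have "\<dots> = ennreal (q * s)" using s0 by (simp add: Em ennreal_mult ennreal_of_nat_eq_real_of_nat)
  finally have EEm: "emeasure lborel EE = ennreal (q * s)" .
  have "c * \<epsilon> / 2 = (c * M) * s" using M0 by (simp add: s_def)
  also have "\<dots> \<le> q * s" using qc s0 by (intro mult_right_mono) auto
  finally have "ennreal (c * \<epsilon> / 2) \<le> emeasure lborel EE" unfolding EEm by (rule ennreal_leI)
  moreover have "\<forall>x\<in>EE. norm (birkhoff \<alpha> (step_cocycle I J e) q x) \<le> 2 * (\<Sum>i\<in>I. norm (J i)) \<and>
      birkhoff \<alpha> (step_cocycle I J e) q (x + s) = birkhoff \<alpha> (step_cocycle I J e) q x + J i0"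
    using birkhoff_step_cocycle_bound[OF q(1,3) approx J] iso(2) by (auto simp: EE_def)
  moreover have "EE \<subseteq> {0..<1}" by (auto simp: EE_def E_def)
  ultimately show "\<exists>q s E. \<bar>s\<bar> < \<eta> \<and> E \<in> sets borel \<and> E \<subseteq> {0..<1} \<and> ennreal (c * \<epsilon> / 2) \<le> emeasure lborel E \<and>
      (\<forall>x\<in>E. norm (birkhoff \<alpha> (step_cocycle I J e) q x) \<le> 2 * (\<Sum>i\<in>I. norm (J i)) \<and>
        birkhoff \<alpha> (step_cocycle I J e) q (x + s) = birkhoff \<alpha> (step_cocycle I J e) q x + J i0)"
    using s s0 EEb by (intro exI[of _ q] exI[of _ s] exI[of _ EE]) simp
qed

text \<open>The directions are arbitrary so that degenerate positions fit in: steps at one point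
  merge into a single step with the sum of the directions.\<close>

definition two_step :: "real \<Rightarrow> real \<Rightarrow> 'b \<Rightarrow> 'b \<Rightarrow> real \<Rightarrow> 'b::real_vector" where
  "two_step b c u v x = (frac (x - b) - frac x) *\<^sub>R u + (frac (x - c) - frac x) *\<^sub>R v"

lemma two_step_borel:
  fixes u :: "'b::euclidean_space"
  shows "two_step b c u v \<in> borel_measurable borel"
  unfolding two_step_def frac_def by measurable

text \<open>A step in direction u is floor x - floor (x - b) - b times u: it goes up at 0 and down
  at b. The two upward jumps coincide at 0.\<close>

definition three_jumps :: "'b \<Rightarrow> 'b \<Rightarrow> nat \<Rightarrow> 'b::real_vector" where
  "three_jumps u v i = (if i = 0 then u + v else if i = 1 then - u else - v)"

definition three_points :: "real \<Rightarrow> real \<Rightarrow> nat \<Rightarrow> real" where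
  "three_points b c i = (if i = 0 then 0 else if i = 1 then b else c)"

lemma two_step_eq_step_cocycle:
  "two_step b c u v = step_cocycle {0, 1, 2} (three_jumps u v) (three_points b c)"
  by (rule ext) (simp add: two_step_def step_cocycle_def three_jumps_def three_points_def frac_def algebra_simps)

context
  fixes c \<alpha> :: real and b d :: real and u v :: "'b::euclidean_space" and B :: "(real \<times> 'b) set"
  assumes bad: "badly_approximable c \<alpha>" and B: "skew_invariant \<alpha> (two_step b d u v) B"
begin

lemma two_step_isolated:
  assumes "0 < \<epsilon>" "\<epsilon> \<le> c" "i0 \<in> {0, 1, 2}"
    and "\<And>N0. \<exists>M\<ge>N0. \<forall>i\<in>{0, 1, 2} - {i0}. separated \<alpha> \<epsilon> M (three_points b d i0 - three_points b d i)"
  shows "(0, three_jumps u v i0) \<in> ae_periods B"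
proof (rule isolated_jump_is_period[OF bad, where I = "{0, 1, 2}" and J = "three_jumps u v"
      and e = "three_points b d" and ?i0.0 = i0])
  show "skew_invariant \<alpha> (step_cocycle {0, 1, 2} (three_jumps u v) (three_points b d)) B"
    using B unfolding two_step_eq_step_cocycle .
  show "sum (three_jumps u v) {0, 1, 2} = 0" by (simp add: three_jumps_def)
qed (use assms in auto)

lemma two_step_period_sum:
  assumes "0 < \<epsilon>" "\<epsilon> \<le> c" "\<And>N0. \<exists>M\<ge>N0. separated \<alpha> \<epsilon> M b \<and> separated \<alpha> \<epsilon> M d"
  shows "(0, u + v) \<in> ae_periods B"
proof -
  have "(0, three_jumps u v 0) \<in> ae_periods B"
  proof (rule two_step_isolated[OF assms(1,2)])
    show "\<exists>M\<ge>N0. \<forall>i\<in>{0, 1, 2} - {0}. separated \<alpha> \<epsilon> M (three_points b d 0 - three_points b d i)" for N0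
      using assms(3)[of N0] by (auto simp: three_points_def separated_minus)
  qed simp
  then show ?thesis by (simp add: three_jumps_def)
qed

lemma two_step_period_left:
  assumes "0 < \<epsilon>" "\<epsilon> \<le> c" "\<And>N0. \<exists>M\<ge>N0. separated \<alpha> \<epsilon> M b \<and> separated \<alpha> \<epsilon> M (b - d)"
  shows "(0, u) \<in> ae_periods B"
proof -
  have "(0, three_jumps u v 1) \<in> ae_periods B"
  proof (rule two_step_isolated[OF assms(1,2)])
    show "\<exists>M\<ge>N0. \<forall>i\<in>{0, 1, 2} - {1}. separated \<alpha> \<epsilon> M (three_points b d 1 - three_points b d i)" for N0
      using assms(3)[of N0] by (auto simp: three_points_def)
  qed simp
  then have "(0, - u) \<in> ae_periods B" by (simp add: three_jumps_def)
  then show ?thesis using ae_periods_minus by fastforce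
qed

lemma two_step_period_right:
  assumes "0 < \<epsilon>" "\<epsilon> \<le> c" "\<And>N0. \<exists>M\<ge>N0. separated \<alpha> \<epsilon> M d \<and> separated \<alpha> \<epsilon> M (b - d)"
  shows "(0, v) \<in> ae_periods B"
proof -
  have "(0, three_jumps u v 2) \<in> ae_periods B"
  proof (rule two_step_isolated[OF assms(1,2)])
    show "\<exists>M\<ge>N0. \<forall>i\<in>{0, 1, 2} - {2}. separated \<alpha> \<epsilon> M (three_points b d 2 - three_points b d i)" for N0
      using assms(3)[of N0] separated_minus[of \<alpha> \<epsilon> _ "b - d"] by (auto simp: three_points_def)
  qed simp
  then have "(0, - v) \<in> ae_periods B" by (simp add: three_jumps_def)
  then show ?thesis using ae_periods_minus by fastforce
qed

text \<open>At a scale where two of the points \<open>0, b, d\<close> are far apart, the third one is far from at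
  least one of them; this yields two of the three periods \<open>u, v, u + v\<close>.\<close>

lemma two_step_periods:
  assumes b: "\<not> on_orbit \<alpha> b" and d: "\<not> on_orbit \<alpha> d" and bd: "\<not> on_orbit \<alpha> (b - d)"
  shows "(0, u) \<in> ae_periods B \<and> (0, v) \<in> ae_periods B"
proof -
  have c: "0 < c / 36" "c / 36 \<le> c" using bad by (auto simp: badly_approximable_def)
  let ?s = "separated \<alpha> (c / 36)"
  \<comment> \<open>Pigeonhole: the dichotomy offers one of two alternatives at arbitrarily large
    scales, so one of them recurs at arbitrarily large scales.\<close>
  have split: "(\<forall>N0. \<exists>M\<ge>N0. ?s M x \<and> ?s M y) \<or> (\<forall>N0. \<exists>M\<ge>N0. ?s M x \<and> ?s M (x - y))"
    if "\<not> on_orbit \<alpha> x" for x y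
  proof (rule ccontr)
    assume "\<not> ?thesis"
    then obtain N1 N2 where N: "\<And>M. N1 \<le> M \<Longrightarrow> \<not> (?s M x \<and> ?s M y)" "\<And>M. N2 \<le> M \<Longrightarrow> \<not> (?s M x \<and> ?s M (x - y))"
      by blast
    from frequently_separated_dichotomy[OF bad that, of "max N1 N2" y] N show False by auto
  qed
  have s1: "(0, u + v) \<in> ae_periods B \<or> (0, u) \<in> ae_periods B"
    using split[OF b, of d] two_step_period_sum[OF c] two_step_period_left[OF c] by blast
  have "?s M (d - b) \<longleftrightarrow> ?s M (b - d)" for M using separated_minus[of \<alpha> "c / 36" M "b - d"] by simp
  then have s2: "(0, u + v) \<in> ae_periods B \<or> (0, v) \<in> ae_periods B"
    using split[OF d, of b] two_step_period_sum[OF c] two_step_period_right[OF c] by metis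
  have "?s M (b - d - b) \<longleftrightarrow> ?s M d" for M using separated_minus[of \<alpha> "c / 36" M d] by simp
  then have s3: "(0, u) \<in> ae_periods B \<or> (0, v) \<in> ae_periods B"
    using split[OF bd, of b] two_step_period_left[OF c] two_step_period_right[OF c] by metis
  have "(0, v) \<in> ae_periods B" if "(0, u + v) \<in> ae_periods B" "(0, u) \<in> ae_periods B"
    using ae_periods_diff[OF that] by simp
  moreover have "(0, u) \<in> ae_periods B" if "(0, u + v) \<in> ae_periods B" "(0, v) \<in> ae_periods B"
    using ae_periods_diff[OF that] by simp
  ultimately show ?thesis using s1 s2 s3 by blast
qed

end

text \<open>For the jump at 0 only the distances from 0 to the other two points matter, so it is
  harmless that these coincide.\<close>

lemma one_step_period:
  fixes u :: "'b::euclidean_space"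
  assumes bad: "badly_approximable c \<alpha>" and B: "skew_invariant \<alpha> (two_step b b u 0) B"
    and b: "\<not> on_orbit \<alpha> b"
  shows "(0, u) \<in> ae_periods B"
proof -
  have c: "0 < c / 6" "c / 6 \<le> c" using bad by (auto simp: badly_approximable_def)
  have "\<exists>M\<ge>N0. separated \<alpha> (c / 6) M b" for N0
    by (rule frequently_separated[OF bad b])
  then have "(0, u + 0) \<in> ae_periods B" by (intro two_step_period_sum[OF bad B c]) auto
  then show ?thesis by simp
qed

section \<open>Borel sections and Haar measure\<close>

lemma Inf_fibre_attained:
  fixes E :: "('a::euclidean_space \<times> 'b::euclidean_space) set" and f :: "'b \<Rightarrow> real"
  assumes E: "closed E" and f: "continuous_on UNIV f" and coercive: "\<And>t. compact {y. f y \<le> t}"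
    and y0: "(x, y0) \<in> E"
  obtains y where "(x, y) \<in> E" "f y = Inf (f ` {y. (x, y) \<in> E})"
    "\<And>y'. (x, y') \<in> E \<Longrightarrow> f y \<le> f y'"
proof -
  have "closed (Pair x -` E)" by (intro closed_vimage[OF E] continuous_intros)
  then have "closed {y. (x, y) \<in> E}" by (simp add: vimage_def)
  then have "compact ({y. (x, y) \<in> E} \<inter> {y. f y \<le> f y0})" using coercive by (rule closed_Int_compact)
  then obtain y where y: "y \<in> {y. (x, y) \<in> E} \<inter> {y. f y \<le> f y0}"
    "\<And>y'. y' \<in> {y. (x, y) \<in> E} \<inter> {y. f y \<le> f y0} \<Longrightarrow> f y \<le> f y'"
    using continuous_attains_inf[of "{y. (x, y) \<in> E} \<inter> {y. f y \<le> f y0}" f] y0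
      continuous_on_subset[OF f subset_UNIV] by auto
  have min: "f y \<le> f y'" if "(x, y') \<in> E" for y'
    using y(1) y(2)[of y'] that by (cases "f y' \<le> f y0") auto
  then have "Inf (f ` {y. (x, y) \<in> E}) = f y" using y(1) by (intro cInf_eq_minimum) auto
  with y(1) min show thesis by (intro that[of y]) auto
qed

text \<open>Apart from empty fibres, a sublevel set is the projection of a closed set along a
  compact one, hence closed.\<close>

lemma Inf_fibre_borel:
  fixes E :: "('a::euclidean_space \<times> 'b::euclidean_space) set" and f :: "'b \<Rightarrow> real"
  assumes E: "closed E" and f: "continuous_on UNIV f" and coercive: "\<And>t. compact {y. f y \<le> t}"
  shows "(\<lambda>x. Inf (f ` {y. (x, y) \<in> E})) \<in> borel_measurable borel"
proof -
  have proj: "closed {x. \<exists>y. f y \<le> t \<and> (x, y) \<in> E}" for t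
  proof -
    have "closed (prod.swap -` E)"
      unfolding prod.swap_def[abs_def] by (intro closed_vimage[OF E] continuous_intros)
    from closed_compact_projection[OF coercive[of t] this] show ?thesis by simp
  qed
  define N where "N = {x. \<exists>y. (x, y) \<in> E}"
  have "N = (\<Union>n::nat. {x. \<exists>y. f y \<le> real n \<and> (x, y) \<in> E})"
    unfolding N_def using real_arch_simple by blast
  then have N: "N \<in> sets borel" using proj by auto
  show ?thesis
    unfolding borel_measurable_iff_le
  proof
    fix t :: real
    \<comment> \<open>Empty fibres do occur when this is applied to \<open>E2\<close> and
      \<open>E3\<close>; there the infimum is the fixed value \<open>Inf {}\<close>.\<close>
    have "{x \<in> space borel. Inf (f ` {y. (x, y) \<in> E}) \<le> t} =
      {x. \<exists>y. f y \<le> t \<and> (x, y) \<in> E} \<union> (if Inf {} \<le> t then - N else {})"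
    proof (rule set_eqI)
      fix x
      show "x \<in> {x \<in> space borel. Inf (f ` {y. (x, y) \<in> E}) \<le> t} \<longleftrightarrow>
        x \<in> {x. \<exists>y. f y \<le> t \<and> (x, y) \<in> E} \<union> (if Inf {} \<le> t then - N else {})"
      proof (cases "x \<in> N")
        case True
        then obtain y0 where "(x, y0) \<in> E" by (auto simp: N_def)
        from Inf_fibre_attained[OF E f coercive this] obtain y where
          y: "(x, y) \<in> E" "f y = Inf (f ` {y. (x, y) \<in> E})" "\<And>y'. (x, y') \<in> E \<Longrightarrow> f y \<le> f y'" by blast
        have "f y \<le> t \<longleftrightarrow> (\<exists>y. f y \<le> t \<and> (x, y) \<in> E)" using y(1,3) order_trans by blast
        then show ?thesis using True by (simp add: y(2)[symmetric])
      next
        case False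
        then have "{y. (x, y) \<in> E} = {}" by (auto simp: N_def)
        with False show ?thesis by (auto simp: N_def)
      qed
    qed
    then show "{x \<in> space borel. Inf (f ` {y. (x, y) \<in> E}) \<le> t} \<in> sets borel"
      using proj[of t] N by auto
  qed
qed

text \<open>The coefficient 2 leaves at least norm y even when g is as negative as possible.\<close>

lemma compact_sublevel_norm_plus:
  fixes g :: "'b::euclidean_space \<Rightarrow> real"
  assumes g: "continuous_on UNIV g" and le: "\<And>y. \<bar>g y\<bar> \<le> norm y"
  shows "compact {y. 2 * norm y + g y \<le> t}"
proof -
  have "closed ((\<lambda>y. 2 * norm y + g y) -` {..t})"
    by (intro closed_vimage continuous_intros g)
  moreover have "{y. 2 * norm y + g y \<le> t} \<subseteq> cball 0 t"
  proof
    fix y assume "y \<in> {y. 2 * norm y + g y \<le> t}"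
    with le[of y] show "y \<in> cball 0 t" by simp
  qed
  ultimately show ?thesis
    by (simp add: compact_eq_bounded_closed vimage_def bounded_subset[OF bounded_cball])
qed

text \<open>The selected point is the lexicographically smallest one among those of minimal norm.\<close>

lemma borel_selection:
  fixes E :: "('a::euclidean_space \<times> real \<times> real) set"
  assumes E: "closed E" and ne: "\<And>x. \<exists>y. (x, y) \<in> E"
  obtains \<sigma> where "\<sigma> \<in> borel_measurable borel" "\<And>x. (x, \<sigma> x) \<in> E"
    "\<And>x y. (x, y) \<in> E \<Longrightarrow> norm (\<sigma> x) \<le> norm y"
    "\<And>x x'. (\<And>y. (x, y) \<in> E \<longleftrightarrow> (x', y) \<in> E) \<Longrightarrow> \<sigma> x = \<sigma> x'"
proof -
  \<comment> \<open>On a sphere, minimising \<open>f2\<close> or \<open>f3\<close> minimises a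
    coordinate; the norm term only makes sublevel sets compact and is subtracted again in
    \<open>\<sigma>\<close>.\<close>
  define f2 f3 :: "real \<times> real \<Rightarrow> real" where "f2 y = 2 * norm y + fst y" and "f3 y = 2 * norm y + snd y" for y
  have cont: "continuous_on UNIV (norm :: real \<times> real \<Rightarrow> real)" "continuous_on UNIV f2" "continuous_on UNIV f3"
    unfolding f2_def f3_def by (intro continuous_intros)+
  have c1: "compact {y :: real \<times> real. norm y \<le> t}" for t
    using compact_cball[of "0 :: real \<times> real" t] by (simp add: cball_def dist_norm)
  have c2: "compact {y. f2 y \<le> t}" for t
    unfolding f2_def
  proof (rule compact_sublevel_norm_plus)
    show "\<bar>fst y\<bar> \<le> norm y" for y :: "real \<times> real" using norm_fst_le[of "fst y" "snd y"] by simp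
  qed (intro continuous_intros)
  have c3: "compact {y. f3 y \<le> t}" for t
    unfolding f3_def
  proof (rule compact_sublevel_norm_plus)
    show "\<bar>snd y\<bar> \<le> norm y" for y :: "real \<times> real" using norm_snd_le[of "snd y" "fst y"] by simp
  qed (intro continuous_intros)
  define m1 where "m1 x = Inf (norm ` {y. (x, y) \<in> E})" for x
  \<comment> \<open>The minima found so far become extra parameters: \<open>m1\<close> is only
    Borel, so imposing norm y = \<open>m1 x\<close> directly need not give a closed set.\<close>
  define E2 where "E2 = {p. (fst (fst p), snd p) \<in> E \<and> norm (snd p) = snd (fst p)}"
  define m2 where "m2 x = Inf (f2 ` {y. ((x, m1 x), y) \<in> E2})" for x
  define E3 where "E3 = {p. (fst (fst p), snd p) \<in> E \<and> norm (snd p) = fst (snd (fst p)) \<and> f2 (snd p) = snd (snd (fst p))}"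
  define m3 where "m3 x = Inf (f3 ` {y. ((x, m1 x, m2 x), y) \<in> E3})" for x
  define \<sigma> where "\<sigma> x = (m2 x - 2 * m1 x, m3 x - 2 * m1 x)" for x
  have E2: "closed E2"
  proof -
    have "closed ((\<lambda>p :: ('a \<times> real) \<times> real \<times> real. (fst (fst p), snd p)) -` E \<inter> {p. norm (snd p) = snd (fst p)})"
      by (intro closed_Int closed_vimage[OF E] closed_Collect_eq continuous_intros)
    then show ?thesis by (simp add: E2_def vimage_def Int_def)
  qed
  have E3: "closed E3"
  proof -
    have "closed ((\<lambda>p :: ('a \<times> real \<times> real) \<times> real \<times> real. (fst (fst p), snd p)) -` E \<inter>
      {p. norm (snd p) = fst (snd (fst p))} \<inter> {p. f2 (snd p) = snd (snd (fst p))})"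
      unfolding f2_def by (intro closed_Int closed_vimage[OF E] closed_Collect_eq continuous_intros)
    moreover have "E3 = (\<lambda>p :: ('a \<times> real \<times> real) \<times> real \<times> real. (fst (fst p), snd p)) -` E \<inter>
      {p. norm (snd p) = fst (snd (fst p))} \<inter> {p. f2 (snd p) = snd (snd (fst p))}"
      by (auto simp: E3_def)
    ultimately show ?thesis by simp
  qed
  have b1: "m1 \<in> borel_measurable borel"
    unfolding m1_def[abs_def] by (rule Inf_fibre_borel[OF E cont(1) c1])
  have "(\<lambda>x. (x, m1 x)) \<in> borel_measurable borel" using b1 by (intro borel_measurable_Pair) auto
  from measurable_compose[OF this Inf_fibre_borel[OF E2 cont(2) c2]]
  have b2: "m2 \<in> borel_measurable borel" by (simp add: m2_def[abs_def])
  have "(\<lambda>x. (x, m1 x, m2 x)) \<in> borel_measurable borel"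
    using b1 b2 by (intro borel_measurable_Pair) auto
  from measurable_compose[OF this Inf_fibre_borel[OF E3 cont(3) c3]]
  have b3: "m3 \<in> borel_measurable borel" by (simp add: m3_def[abs_def])
  have \<sigma>b: "\<sigma> \<in> borel_measurable borel"
    unfolding \<sigma>_def[abs_def] using b1 b2 b3
    by (intro borel_measurable_Pair borel_measurable_diff borel_measurable_times) auto
  have sel: "(x, \<sigma> x) \<in> E \<and> norm (\<sigma> x) = m1 x" for x
  proof -
    obtain y0 where "(x, y0) \<in> E" using ne by blast
    from Inf_fibre_attained[OF E cont(1) c1 this]
    obtain y1 where "(x, y1) \<in> E" "norm y1 = m1 x" unfolding m1_def by metis
    then have "((x, m1 x), y1) \<in> E2" by (simp add: E2_def)
    from Inf_fibre_attained[OF E2 cont(2) c2 this]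
    obtain y2 where "((x, m1 x), y2) \<in> E2" "f2 y2 = m2 x" unfolding m2_def by metis
    then have "((x, m1 x, m2 x), y2) \<in> E3" by (simp add: E2_def E3_def)
    from Inf_fibre_attained[OF E3 cont(3) c3 this]
    obtain y3 where y3: "((x, m1 x, m2 x), y3) \<in> E3" "f3 y3 = m3 x" unfolding m3_def by metis
    then have "norm y3 = m1 x" "f2 y3 = m2 x" "(x, y3) \<in> E" by (auto simp: E3_def)
    moreover from this y3(2) have "\<sigma> x = y3" by (simp add: \<sigma>_def f2_def f3_def prod_eq_iff)
    ultimately show ?thesis by simp
  qed
  have min: "norm (\<sigma> x) \<le> norm y" if "(x, y) \<in> E" for x y
  proof -
    have "m1 x \<le> norm y" unfolding m1_def using that by (intro cInf_lower) (auto intro: bdd_belowI[of _ 0])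
    with sel[of x] show ?thesis by simp
  qed
  have dep: "\<sigma> x = \<sigma> x'" if "\<And>y. (x, y) \<in> E \<longleftrightarrow> (x', y) \<in> E" for x x'
  proof -
    have 1: "m1 x = m1 x'" using that by (simp add: m1_def)
    then have 2: "m2 x = m2 x'" using that by (simp add: m2_def E2_def)
    with 1 have "m3 x = m3 x'" using that by (simp add: m3_def E3_def)
    with 1 2 show ?thesis by (simp add: \<sigma>_def)
  qed
  show thesis by (rule that[OF \<sigma>b _ min dep]) (use sel in auto)
qed

section \<open>Haar measure on a closed subgroup\<close>

lemma closed_subgroup_minus: "closed_subgroup H \<Longrightarrow> h \<in> H \<Longrightarrow> - h \<in> H"
  unfolding closed_subgroup_def by (metis diff_0)

lemma closed_subgroup_add: "closed_subgroup H \<Longrightarrow> g \<in> H \<Longrightarrow> h \<in> H \<Longrightarrow> g + h \<in> H"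
  using closed_subgroup_minus[of H h] unfolding closed_subgroup_def by (metis diff_minus_eq_add)

text \<open>The vector y - \<pi> y represents the coset y + H. The norm bound puts the unit ball
  into the region pushed forward by \<open>haar_of\<close>, so that measure is not zero.\<close>

definition equivariant_retraction :: "'a::euclidean_space set \<Rightarrow> ('a \<Rightarrow> 'a) \<Rightarrow> bool" where
  "equivariant_retraction H \<pi> \<longleftrightarrow> \<pi> \<in> borel_measurable borel \<and> (\<forall>y. \<pi> y \<in> H) \<and>
     (\<forall>y. \<forall>h\<in>H. \<pi> (y + h) = \<pi> y + h) \<and> (\<forall>y. norm (y - \<pi> y) \<le> norm y)"

text \<open>Select an element r y of minimal norm in y + H. It depends only on the coset, which
  makes y - r y equivariant, and y itself is a competitor, which gives the norm bound.\<close>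

lemma equivariant_retraction_exists:
  fixes H :: "(real \<times> real) set"
  assumes H: "closed_subgroup H"
  obtains \<pi> where "equivariant_retraction H \<pi>"
proof -
  have clH: "closed H" and H0: "0 \<in> H" and Hd: "\<And>x y. x \<in> H \<Longrightarrow> y \<in> H \<Longrightarrow> x - y \<in> H"
    using H by (auto simp: closed_subgroup_def)
  define E where "E = {p :: (real \<times> real) \<times> real \<times> real. snd p - fst p \<in> H}"
  have "closed ((\<lambda>p :: (real \<times> real) \<times> real \<times> real. snd p - fst p) -` H)"
    by (intro closed_vimage[OF clH] continuous_intros)
  then have "closed E" by (simp add: E_def vimage_def)
  moreover have "\<exists>z. (y, z) \<in> E" for y using H0 by (intro exI[of _ y]) (simp add: E_def)
  ultimately obtain r where r: "r \<in> borel_measurable borel" "\<And>y. (y, r y) \<in> E"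
    "\<And>y z. (y, z) \<in> E \<Longrightarrow> norm (r y) \<le> norm z"
    "\<And>y y'. (\<And>z. (y, z) \<in> E \<longleftrightarrow> (y', z) \<in> E) \<Longrightarrow> r y = r y'"
    by (rule borel_selection) blast
  have "equivariant_retraction H (\<lambda>y. y - r y)"
    unfolding equivariant_retraction_def
  proof (intro conjI allI ballI)
    show "(\<lambda>y. y - r y) \<in> borel_measurable borel" using r(1) by (intro borel_measurable_diff) auto
    show "y - r y \<in> H" for y
      using r(2)[of y] closed_subgroup_minus[OF H, of "r y - y"] by (simp add: E_def)
    show "norm (y - (y - r y)) \<le> norm y" for y
      using r(3)[of y y] H0 by (simp add: E_def)
    fix y h assume h: "h \<in> H"
    have "r (y + h) = r y"
    proof (rule r(4))
      fix z
      have "z - (y + h) \<in> H \<longleftrightarrow> z - y \<in> H"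
        using Hd[of "z - y" h] closed_subgroup_add[OF H, of "z - (y + h)" h] h by (auto simp: algebra_simps)
      then show "(y + h, z) \<in> E \<longleftrightarrow> (y, z) \<in> E" by (simp add: E_def)
    qed
    then show "y + h - r (y + h) = y - r y + h" by simp
  qed
  then show thesis by (rule that)
qed

text \<open>Lebesgue measure of the points close to \<open>H\<close>, pushed to \<open>H\<close> by the retraction: it is invariant
  because \<open>\<pi>\<close> and \<open>y \<mapsto> y - \<pi> y\<close> are equivariant and invariant under \<open>H\<close>.\<close>

definition haar_of :: "'a::euclidean_space set \<Rightarrow> ('a \<Rightarrow> 'a) \<Rightarrow> 'a measure" where
  "haar_of H \<pi> = distr (restrict_space lborel {y. norm (y - \<pi> y) \<le> 1}) (restrict_space borel H) \<pi>"

context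
  fixes H :: "'a::euclidean_space set" and \<pi> :: "'a \<Rightarrow> 'a"
  assumes H: "closed_subgroup H" and \<pi>: "equivariant_retraction H \<pi>"
begin

lemma retraction_facts:
  shows "\<pi> \<in> borel_measurable borel" "\<And>y. \<pi> y \<in> H" "\<And>y h. h \<in> H \<Longrightarrow> \<pi> (y + h) = \<pi> y + h"
    "\<And>y. norm (y - \<pi> y) \<le> norm y"
  using \<pi> by (auto simp: equivariant_retraction_def)

lemma subgroup_borel: "H \<in> sets borel"
  using H by (auto simp: closed_subgroup_def)

lemma sets_restrict_subgroup: "S \<in> sets (restrict_space borel H) \<longleftrightarrow> S \<in> sets borel \<and> S \<subseteq> H"
  using subgroup_borel by (subst sets_restrict_space_iff) auto

lemma near_borel: "{y. norm (y - \<pi> y) \<le> 1} \<in> sets borel"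
proof -
  have "{y \<in> space borel. norm (y - \<pi> y) \<le> 1} \<in> sets borel" using retraction_facts(1) by measurable
  then show ?thesis by simp
qed

lemma near_vimage_borel:
  assumes "S \<in> sets borel"
  shows "{y. norm (y - \<pi> y) \<le> 1 \<and> \<pi> y \<in> S} \<in> sets borel"
proof -
  have "\<pi> -` S \<inter> space borel \<in> sets borel" by (rule measurable_sets[OF retraction_facts(1) assms])
  then have "{y. norm (y - \<pi> y) \<le> 1} \<inter> \<pi> -` S \<in> sets borel" using near_borel by auto
  then show ?thesis by (simp add: vimage_def Int_def)
qed

lemma space_haar_of: "space (haar_of H \<pi>) = H"
  by (simp add: haar_of_def space_restrict_space)

lemma sets_haar_of: "sets (haar_of H \<pi>) = sets (restrict_space borel H)"
  by (simp add: haar_of_def)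

lemma emeasure_haar_of:
  assumes S: "S \<in> sets borel" "S \<subseteq> H"
  shows "emeasure (haar_of H \<pi>) S = emeasure lborel {y. norm (y - \<pi> y) \<le> 1 \<and> \<pi> y \<in> S}"
proof -
  let ?N = "{y. norm (y - \<pi> y) \<le> 1}"
  have "\<pi> \<in> measurable (restrict_space lborel ?N) (restrict_space borel H)"
    using retraction_facts(1,2) by (intro measurable_restrict_space2 measurable_restrict_space1) auto
  then have "emeasure (haar_of H \<pi>) S = emeasure (restrict_space lborel ?N) (\<pi> -` S \<inter> space (restrict_space lborel ?N))"
    unfolding haar_of_def using S by (intro emeasure_distr) (auto simp: sets_restrict_subgroup)
  also have "\<dots> = emeasure lborel (\<pi> -` S \<inter> ?N)"
    using near_borel by (subst emeasure_restrict_space) (auto simp: space_restrict_space)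
  also have "\<pi> -` S \<inter> ?N = {y. norm (y - \<pi> y) \<le> 1 \<and> \<pi> y \<in> S}" by auto
  finally show ?thesis .
qed

lemma emeasure_haar_of_bounded:
  assumes S: "S \<in> sets borel" "S \<subseteq> H" "bounded S"
  shows "emeasure (haar_of H \<pi>) S < \<infinity>"
proof -
  obtain R where R: "\<And>y. y \<in> S \<Longrightarrow> norm y \<le> R" using S(3) by (auto simp: bounded_iff)
  have "{y. norm (y - \<pi> y) \<le> 1 \<and> \<pi> y \<in> S} \<subseteq> cball 0 (R + 1)"
  proof
    fix y assume "y \<in> {y. norm (y - \<pi> y) \<le> 1 \<and> \<pi> y \<in> S}"
    then show "y \<in> cball 0 (R + 1)" using R[of "\<pi> y"] norm_triangle_ineq[of "y - \<pi> y" "\<pi> y"] by simp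
  qed
  then have "bounded {y. norm (y - \<pi> y) \<le> 1 \<and> \<pi> y \<in> S}" by (rule bounded_subset[OF bounded_cball])
  then show ?thesis unfolding emeasure_haar_of[OF S(1,2)] by (rule emeasure_bounded_finite)
qed

lemma image_add_subgroup:
  assumes "h \<in> H" "S \<subseteq> H" "S \<in> sets borel"
  shows "(+) h ` S \<in> sets borel" "(+) h ` S \<subseteq> H" "(+) h ` S = {y. y + - h \<in> S}"
proof -
  show eq: "(+) h ` S = {y. y + - h \<in> S}"
    by (auto simp: image_iff) (metis add.commute diff_add_cancel)
  show "(+) h ` S \<in> sets borel" unfolding eq by (rule borel_vimage_translate) fact
  show "(+) h ` S \<subseteq> H" using assms closed_subgroup_add[OF H] by auto
qed

lemma emeasure_haar_of_translate:
  assumes h: "h \<in> H" and S: "S \<in> sets borel" "S \<subseteq> H"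
  shows "emeasure (haar_of H \<pi>) ((+) h ` S) = emeasure (haar_of H \<pi>) S"
proof -
  let ?X = "\<lambda>S. {y. norm (y - \<pi> y) \<le> 1 \<and> \<pi> y \<in> S}"
  note im = image_add_subgroup[OF h S(2,1)]
  have "\<pi> (y + - h) = \<pi> y + - h" for y by (intro retraction_facts(3) closed_subgroup_minus[OF H h])
  then have "?X ((+) h ` S) = {y. y + - h \<in> ?X S}" unfolding im(3) by simp
  then show ?thesis
    using emeasure_lborel_translate[OF near_vimage_borel[OF S(1)], of "- h"]
    by (simp only: emeasure_haar_of[OF S] emeasure_haar_of[OF im(1,2)])
qed

lemma haar_of_haar: "haar_measure_on H (haar_of H \<pi>)"
  unfolding haar_measure_on_def
proof (intro conjI allI impI ballI)
  show "space (haar_of H \<pi>) = H" by (rule space_haar_of)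
  show "sets (haar_of H \<pi>) = sets (restrict_space borel H)" by (rule sets_haar_of)
  have "emeasure lborel (ball (0 :: 'a) 1) \<noteq> 0"
    using content_ball_pos[of 1 "0 :: 'a"] by (auto simp: measure_def)
  moreover have "emeasure lborel (ball (0 :: 'a) 1) \<le> emeasure lborel {y. norm (y - \<pi> y) \<le> 1 \<and> \<pi> y \<in> H}"
    using near_vimage_borel[OF subgroup_borel] retraction_facts(2) order_trans[OF retraction_facts(4)]
    by (intro emeasure_mono) auto
  ultimately show "emeasure (haar_of H \<pi>) H \<noteq> 0" by (auto simp: emeasure_haar_of[OF subgroup_borel])
  fix K assume "compact K \<and> K \<subseteq> H"
  then show "emeasure (haar_of H \<pi>) K < \<infinity>"
    by (intro emeasure_haar_of_bounded) (auto simp: compact_imp_bounded borel_compact)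
next
  fix h A assume "h \<in> H" "A \<in> sets (haar_of H \<pi>)"
  then show "emeasure (haar_of H \<pi>) ((+) h ` A) = emeasure (haar_of H \<pi>) A"
    by (intro emeasure_haar_of_translate) (auto simp: sets_haar_of sets_restrict_subgroup)
qed

lemma haar_of_sigma_finite: "sigma_finite_measure (haar_of H \<pi>)"
proof
  let ?A = "range (\<lambda>n::nat. H \<inter> cball 0 (real n))"
  have b: "H \<inter> cball 0 r \<in> sets borel" for r using subgroup_borel by auto
  have "\<exists>n::nat. norm h \<le> real n" for h :: 'a by (rule real_arch_simple)
  then have U: "\<Union> ?A = H" by auto
  have "emeasure (haar_of H \<pi>) (H \<inter> cball 0 r) \<noteq> \<infinity>" for r
    by (rule less_imp_neq, rule emeasure_haar_of_bounded[OF b]) (auto intro: bounded_subset[OF bounded_cball])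
  then have fin: "\<forall>a\<in>?A. emeasure (haar_of H \<pi>) a \<noteq> \<infinity>" by blast
  have sub: "?A \<subseteq> sets (haar_of H \<pi>)" using b by (auto simp: sets_haar_of sets_restrict_subgroup)
  show "\<exists>A. countable A \<and> A \<subseteq> sets (haar_of H \<pi>) \<and> \<Union> A = space (haar_of H \<pi>) \<and>
      (\<forall>a\<in>A. emeasure (haar_of H \<pi>) a \<noteq> \<infinity>)"
    unfolding space_haar_of by (rule exI[of _ ?A]) (intro conjI U fin sub countable_image countableI_type)
qed

end

section \<open>Ergodicity of the reduced cocycle\<close>

lemma space_circle: "space circle = {0..<1}"
  by (simp add: circle_def space_restrict_space)

lemma sets_circle: "A \<in> sets circle \<longleftrightarrow> A \<in> sets borel \<and> A \<subseteq> {0..<1}"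
  unfolding circle_def by (subst sets_restrict_space_iff) auto

lemma emeasure_circle: "A \<subseteq> {0..<1} \<Longrightarrow> emeasure circle A = emeasure lborel A"
  unfolding circle_def by (rule emeasure_restrict_space) auto

lemma finite_measure_circle: "finite_measure circle"
  by (rule finite_measureI) (simp add: space_circle emeasure_circle)

lemma measurable_circle: "f \<in> measurable borel N \<Longrightarrow> f \<in> measurable circle N"
  unfolding circle_def by (rule measurable_restrict_space1) simp

lemma measurable_into_circle:
  assumes "f \<in> borel_measurable M"
  shows "(\<lambda>x. frac (f x)) \<in> measurable M circle"
  unfolding circle_def
proof (rule measurable_restrict_space2)
  show "(\<lambda>x. frac (f x)) \<in> measurable M lborel" using assms unfolding frac_def by measurable
qed (simp add: frac_lt_1)

lemma circle_translate: "measure_preserving circle (\<lambda>x. frac (x + t))"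
  unfolding measure_preserving_def
proof (intro conjI measure_eqI)
  show m: "(\<lambda>x. frac (x + t)) \<in> measurable circle circle"
    by (intro measurable_into_circle measurable_circle) simp
  fix A assume "A \<in> sets (distr circle circle (\<lambda>x. frac (x + t)))"
  then have A: "A \<in> sets circle" by simp
  define P where "P = frac -` A"
  have "(frac :: real \<Rightarrow> real) \<in> borel_measurable borel" unfolding frac_def[abs_def] by measurable
  from measurable_sets[OF this, of A] have P: "P \<in> sets borel"
    using A by (simp add: P_def sets_circle)
  have per: "x + 1 \<in> P \<longleftrightarrow> x \<in> P" for x by (simp add: P_def frac_1_eq)
  have "emeasure (distr circle circle (\<lambda>x. frac (x + t))) A = emeasure circle {x \<in> {0..<1}. x + t \<in> P}"
    by (subst emeasure_distr[OF m A]) (auto simp: P_def space_circle intro!: arg_cong[where f = "emeasure circle"])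
  also have "\<dots> = emeasure lborel {x \<in> {0..<1}. x + t \<in> P}" by (rule emeasure_circle) auto
  also have "\<dots> = emeasure lborel (P \<inter> {0..<1})" by (rule emeasure_periodic_translate[OF P per])
  also have "P \<inter> {0..<1} = A"
    using A by (auto simp: P_def sets_circle frac_eq[THEN iffD2])
  finally show "emeasure (distr circle circle (\<lambda>x. frac (x + t))) A = emeasure circle A"
    using A by (simp add: emeasure_circle sets_circle)
qed simp

lemma measurable_haar_of_id:
  assumes "closed_subgroup H" "equivariant_retraction H \<pi>"
  shows "(\<lambda>h. h) \<in> borel_measurable (haar_of H \<pi>)"
  unfolding measurable_cong_sets[OF sets_haar_of[OF assms] refl]
  by (intro measurable_restrict_space1) simp

lemma measurable_into_haar_of:
  assumes "closed_subgroup H" "equivariant_retraction H \<pi>"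
    and "f \<in> borel_measurable M" "f \<in> space M \<rightarrow> H"
  shows "f \<in> measurable M (haar_of H \<pi>)"
  unfolding measurable_cong_sets[OF refl sets_haar_of[OF assms(1,2)]]
  using assms(3,4) by (intro measurable_restrict_space2)

lemma measurable_circle_haar_of:
  assumes "closed_subgroup H" "equivariant_retraction H \<pi>"
  shows "fst \<in> borel_measurable (circle \<Otimes>\<^sub>M haar_of H \<pi>)"
    and "snd \<in> borel_measurable (circle \<Otimes>\<^sub>M haar_of H \<pi>)"
proof -
  have "(\<lambda>x::real. x) \<in> borel_measurable circle" by (rule measurable_circle) simp
  from measurable_compose[OF measurable_fst this]
  show "fst \<in> borel_measurable (circle \<Otimes>\<^sub>M haar_of H \<pi>)" .
  from measurable_compose[OF measurable_snd measurable_haar_of_id[OF assms]]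
  show "snd \<in> borel_measurable (circle \<Otimes>\<^sub>M haar_of H \<pi>)" .
qed

text \<open>Fubini with invariance of the Haar measure in each fibre. The angle t is free because
  the map is needed for \<alpha> and, in \<open>ergodic_reduced\<close>, for the first coordinate of
  a point chosen by Fubini.\<close>

lemma skew_measure_preserving:
  fixes H :: "'a::euclidean_space set" and g :: "real \<Rightarrow> 'a"
  assumes H: "closed_subgroup H" and \<pi>: "equivariant_retraction H \<pi>"
    and g: "g \<in> borel_measurable borel" and gH: "\<And>x. x \<in> {0..<1} \<Longrightarrow> g x \<in> H"
  shows "measure_preserving (circle \<Otimes>\<^sub>M haar_of H \<pi>) (\<lambda>(x, h). (frac (x + t), h + g x))"
proof -
  let ?\<nu> = "haar_of H \<pi>"
  let ?M = "circle \<Otimes>\<^sub>M ?\<nu>"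
  let ?S = "\<lambda>(x, h). (frac (x + t), h + g x)"
  interpret \<nu>: sigma_finite_measure ?\<nu> by (rule haar_of_sigma_finite[OF H \<pi>])
  have sets\<nu>: "S \<in> sets ?\<nu> \<longleftrightarrow> S \<in> sets borel \<and> S \<subseteq> H" for S
    by (simp add: sets_haar_of[OF H \<pi>] sets_restrict_subgroup[OF H \<pi>])
  have sp: "space ?M = {0..<1} \<times> H"
    by (simp add: space_pair_measure space_circle space_haar_of[OF H \<pi>])
  note fst_b = measurable_circle_haar_of(1)[OF H \<pi>] and snd_b = measurable_circle_haar_of(2)[OF H \<pi>]
  have fst_m: "(\<lambda>z. frac (fst z + t)) \<in> measurable ?M circle"
    by (intro measurable_into_circle borel_measurable_add fst_b) simp
  have "(\<lambda>z. snd z + g (fst z)) \<in> borel_measurable ?M"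
    by (intro borel_measurable_add snd_b measurable_compose[OF fst_b] g)
  then have "(\<lambda>z. snd z + g (fst z)) \<in> measurable ?M ?\<nu>"
    using gH closed_subgroup_add[OF H] by (intro measurable_into_haar_of[OF H \<pi>]) (auto simp: sp)
  with fst_m have "(\<lambda>z. (frac (fst z + t), snd z + g (fst z))) \<in> measurable ?M ?M"
    by (rule measurable_Pair)
  then have m: "?S \<in> measurable ?M ?M" by (simp add: case_prod_unfold)
  have "distr ?M ?M ?S = ?M"
  proof (rule measure_eqI)
    fix A assume "A \<in> sets (distr ?M ?M ?S)"
    then have A: "A \<in> sets ?M" by simp
    have AM: "A \<subseteq> {0..<1} \<times> H" using sets.sets_into_space[OF A] sp by simp
    define a where "a x = emeasure ?\<nu> (Pair x -` A)" for x
    have am: "a \<in> borel_measurable circle"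
      unfolding a_def[abs_def] by (rule \<nu>.measurable_emeasure_Pair[OF A])
    have slice: "emeasure ?\<nu> (Pair x -` (?S -` A \<inter> space ?M)) = a (frac (x + t))" if x: "x \<in> {0..<1}" for x
    proof -
      define X where "X = Pair x -` (?S -` A \<inter> space ?M)"
      have X: "X \<in> sets ?\<nu>" unfolding X_def by (rule sets_Pair1[OF measurable_sets[OF m A]])
      have "(+) (g x) ` X = Pair (frac (x + t)) -` A"
      proof (rule set_eqI)
        fix h
        show "h \<in> (+) (g x) ` X \<longleftrightarrow> h \<in> Pair (frac (x + t)) -` A"
        proof
          assume "h \<in> (+) (g x) ` X"
          then show "h \<in> Pair (frac (x + t)) -` A" by (auto simp: X_def add.commute)
        next
          assume h: "h \<in> Pair (frac (x + t)) -` A"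
          then have "h \<in> H" using AM by auto
          then have "h - g x \<in> H" using H gH[OF x] by (auto simp: closed_subgroup_def)
          then have "h - g x \<in> X" using h x by (auto simp: X_def sp)
          then show "h \<in> (+) (g x) ` X" by (intro image_eqI[of _ _ "h - g x"]) auto
        qed
      qed
      moreover have "emeasure ?\<nu> ((+) (g x) ` X) = emeasure ?\<nu> X"
        using X gH[OF x] by (intro emeasure_haar_of_translate[OF H \<pi>]) (auto simp: sets\<nu>)
      ultimately show ?thesis by (simp add: a_def X_def)
    qed
    have ct: "(\<lambda>x. frac (x + t)) \<in> measurable circle circle" "distr circle circle (\<lambda>x. frac (x + t)) = circle"
      using circle_translate[of t] by (auto simp: measure_preserving_def)
    have "emeasure (distr ?M ?M ?S) A = emeasure ?M (?S -` A \<inter> space ?M)"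
      by (rule emeasure_distr[OF m A])
    also have "\<dots> = (\<integral>\<^sup>+x. emeasure ?\<nu> (Pair x -` (?S -` A \<inter> space ?M)) \<partial>circle)"
      by (rule \<nu>.emeasure_pair_measure_alt[OF measurable_sets[OF m A]])
    also have "\<dots> = (\<integral>\<^sup>+x. a (frac (x + t)) \<partial>circle)"
      by (intro nn_integral_cong slice) (simp add: space_circle)
    also have "\<dots> = (\<integral>\<^sup>+x. a x \<partial>distr circle circle (\<lambda>x. frac (x + t)))"
      by (rule nn_integral_distr[OF ct(1), symmetric]) (use am in simp)
    also have "\<dots> = (\<integral>\<^sup>+x. a x \<partial>circle)" by (simp only: ct(2))
    also have "\<dots> = emeasure ?M A" unfolding a_def by (rule \<nu>.emeasure_pair_measure_alt[OF A, symmetric])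
    finally show "emeasure (distr ?M ?M ?S) A = emeasure ?M A" .
  qed simp
  with m show ?thesis by (simp add: measure_preserving_def)
qed

text \<open>Intersecting over all invariant sets yields one group, so that H and the transfer
  function do not depend on the set tested for ergodicity.\<close>

definition common_periods :: "real \<Rightarrow> (real \<Rightarrow> 'b) \<Rightarrow> (real \<times> 'b::euclidean_space) set" where
  "common_periods \<alpha> \<Phi> = {k. \<forall>B. skew_invariant \<alpha> \<Phi> B \<longrightarrow> k \<in> ae_periods B}"

lemma closed_common_periods: "closed (common_periods \<alpha> \<Phi>)"
proof -
  have "common_periods \<alpha> \<Phi> = (\<Inter>B \<in> Collect (skew_invariant \<alpha> \<Phi>). ae_periods B)"
    by (auto simp: common_periods_def)
  moreover have "closed (\<Inter>B \<in> Collect (skew_invariant \<alpha> \<Phi>). ae_periods B)"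
    by (intro closed_INT ballI closed_ae_periods) (simp add: skew_invariant_def)
  ultimately show ?thesis by simp
qed

lemma common_periods_0: "0 \<in> common_periods \<alpha> \<Phi>"
  by (simp add: common_periods_def ae_periods_0)

lemma common_periods_diff:
  "k \<in> common_periods \<alpha> \<Phi> \<Longrightarrow> l \<in> common_periods \<alpha> \<Phi> \<Longrightarrow> k - l \<in> common_periods \<alpha> \<Phi>"
  by (simp add: common_periods_def ae_periods_diff)

lemma common_periods_add:
  "k \<in> common_periods \<alpha> \<Phi> \<Longrightarrow> l \<in> common_periods \<alpha> \<Phi> \<Longrightarrow> k + l \<in> common_periods \<alpha> \<Phi>"
  by (simp add: common_periods_def ae_periods_add)

lemma common_periods_of_int:
  "k \<in> common_periods \<alpha> \<Phi> \<Longrightarrow> of_int n *\<^sub>R k \<in> common_periods \<alpha> \<Phi>"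
  by (simp add: common_periods_def ae_periods_of_int)

lemma common_periods_one: "(1, 0) \<in> common_periods \<alpha> \<Phi>"
  by (auto simp: common_periods_def ae_periods_def skew_invariant_def)

lemma frac_frac_add: "frac (frac x + a) = frac (x + a)" for x a :: real
proof -
  have "frac x + a = (x + a) + of_int (- \<lfloor>x\<rfloor>)" by (simp add: frac_def)
  then show ?thesis by (simp only: frac_def floor_add_int[symmetric])
qed

lemma common_periods_zero_Pair: "(0, 0) \<in> common_periods \<alpha> \<Phi>"
  using common_periods_0[of \<alpha> \<Phi>] by (simp only: zero_prod_def[symmetric])

lemma closed_subgroup_vertical_periods: "closed_subgroup {h. (0, h) \<in> common_periods \<alpha> \<Phi>}"
  unfolding closed_subgroup_def
proof (intro conjI ballI)
  have "closed (Pair 0 -` common_periods \<alpha> \<Phi>)"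
    by (intro closed_vimage[OF closed_common_periods] continuous_intros)
  then show "closed {h. (0, h) \<in> common_periods \<alpha> \<Phi>}" by (simp add: vimage_def)
  show "0 \<in> {h. (0, h) \<in> common_periods \<alpha> \<Phi>}" using common_periods_zero_Pair by blast
  show "x - y \<in> {h. (0, h) \<in> common_periods \<alpha> \<Phi>}"
    if "x \<in> {h. (0, h) \<in> common_periods \<alpha> \<Phi>}" "y \<in> {h. (0, h) \<in> common_periods \<alpha> \<Phi>}" for x y
    using common_periods_diff[of "(0, x)" \<alpha> \<Phi> "(0, y)"] that by simp
qed

text \<open>Let \<open>K\<close> be the group of common periods. A Borel section \<open>\<sigma>\<close> of \<open>K\<close> over the first
  coordinate is the transfer function that moves \<open>\<Phi>\<close> into \<open>H = {h. (0, h) \<in> K}\<close>. An invariant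
  set of the resulting skew product lifts to an invariant set of \<open>\<Phi>\<close>, which has all periods
  in \<open>K\<close>; these act transitively on the fibres of the lift.\<close>

context
  fixes \<alpha> :: real and \<Phi> :: "real \<Rightarrow> real \<times> real" and \<sigma> :: "real \<Rightarrow> real \<times> real"
    and H :: "(real \<times> real) set" and \<pi> :: "real \<times> real \<Rightarrow> real \<times> real"
  assumes \<Phi>b: "\<Phi> \<in> borel_measurable borel" and \<Phi>per: "\<And>x. \<Phi> (x + 1) = \<Phi> x"
    and \<Phi>K: "\<And>x. (\<alpha>, \<Phi> x) \<in> common_periods \<alpha> \<Phi>"
    and \<sigma>b: "\<sigma> \<in> borel_measurable borel" and \<sigma>K: "\<And>x. (x, \<sigma> x) \<in> common_periods \<alpha> \<Phi>"
    and H_def: "H = {h. (0, h) \<in> common_periods \<alpha> \<Phi>}" and \<pi>: "equivariant_retraction H \<pi>"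
begin

definition reduced where "reduced x = \<Phi> x + \<sigma> x - \<sigma> (rotation \<alpha> x)"

lemma closed_subgroup_H: "closed_subgroup H"
  unfolding H_def by (rule closed_subgroup_vertical_periods)

lemmas retraction = retraction_facts[OF closed_subgroup_H \<pi>]

text \<open>Adding the elements of K over \<alpha> and x and subtracting those over the rotated
  point and over the integer carry leaves a vertical element.\<close>

lemma reduced_H: "reduced x \<in> H"
proof -
  define n where "n = \<lfloor>x + \<alpha>\<rfloor>"
  have "(\<alpha>, \<Phi> x) + (x, \<sigma> x) - (rotation \<alpha> x, \<sigma> (rotation \<alpha> x)) - of_int n *\<^sub>R (1, 0) \<in> common_periods \<alpha> \<Phi>"
    by (intro common_periods_diff common_periods_add common_periods_of_int common_periods_one \<Phi>K \<sigma>K)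
  also have "(\<alpha>, \<Phi> x) + (x, \<sigma> x) - (rotation \<alpha> x, \<sigma> (rotation \<alpha> x)) - of_int n *\<^sub>R (1, 0) = (0, reduced x)"
    by (simp add: reduced_def rotation_def frac_def n_def)
  finally show ?thesis by (simp add: H_def)
qed

lemma rotation_borel: "rotation \<alpha> \<in> borel_measurable borel"
  unfolding rotation_def[abs_def] frac_def by measurable

lemma reduced_borel: "reduced \<in> borel_measurable borel"
  unfolding reduced_def[abs_def]
  by (intro borel_measurable_diff borel_measurable_add \<Phi>b \<sigma>b measurable_compose[OF rotation_borel])

lemma \<Phi>_frac: "\<Phi> (frac x) = \<Phi> x"
  using periodic_of_int[of "\<lambda>y. \<Phi> y = \<Phi> x" x "- \<lfloor>x\<rfloor>"] \<Phi>per by (simp add: frac_def)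

lemma cohomologous_reduced: "cohomologous (rotation \<alpha>) \<Phi> reduced"
  unfolding cohomologous_def
proof (intro bexI)
  show "AE x in circle. \<Phi> x - reduced x = - \<sigma> x - - \<sigma> (rotation \<alpha> x)" by (simp add: reduced_def)
  show "(\<lambda>x. - \<sigma> x) \<in> borel_measurable circle"
    by (intro measurable_circle borel_measurable_uminus \<sigma>b)
qed

lemma skew_product_eq: "skew_product (rotation \<alpha>) reduced = (\<lambda>(x, h). (frac (x + \<alpha>), h + reduced x))"
  by (simp add: skew_product_def rotation_def)

lemma ergodic_reduced: "ergodic (circle \<Otimes>\<^sub>M haar_of H \<pi>) (skew_product (rotation \<alpha>) reduced)"
  unfolding ergodic_def
proof (intro conjI ballI impI)
  let ?M = "circle \<Otimes>\<^sub>M haar_of H \<pi>"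
  note H = closed_subgroup_H
  interpret \<nu>: sigma_finite_measure "haar_of H \<pi>" by (rule haar_of_sigma_finite[OF H \<pi>])
  interpret circ: finite_measure circle by (rule finite_measure_circle)
  interpret M: pair_sigma_finite circle "haar_of H \<pi>" ..
  interpret LM: pair_sigma_finite "lborel :: (real \<times> real \<times> real) measure" ?M ..
  have sp: "space ?M = {0..<1} \<times> H"
    by (simp add: space_pair_measure space_circle space_haar_of[OF H \<pi>])
  show "measure_preserving ?M (skew_product (rotation \<alpha>) reduced)"
    unfolding skew_product_eq by (rule skew_measure_preserving[OF H \<pi> reduced_borel reduced_H])
  fix A assume A: "A \<in> sets ?M" and invA: "skew_product (rotation \<alpha>) reduced -` A \<inter> space ?M = A"
  have inv: "(frac (x + \<alpha>), h + reduced x) \<in> A \<longleftrightarrow> (x, h) \<in> A" if "x \<in> {0..<1}" "h \<in> H" for x h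
  proof -
    have "(x, h) \<in> A \<longleftrightarrow> (x, h) \<in> skew_product (rotation \<alpha>) reduced -` A \<inter> space ?M" by (simp only: invA)
    also have "\<dots> \<longleftrightarrow> (frac (x + \<alpha>), h + reduced x) \<in> A" using that by (simp add: skew_product_eq sp)
    finally show ?thesis ..
  qed
  \<comment> \<open>Map the cover to circle x H by removing the section and retracting. Equivariance
    of \<pi> under the H-valued \<open>reduced\<close> intertwines the two skew products, so B is
    invariant.\<close>
  define \<theta> where "\<theta> p = (frac (fst p), \<pi> (snd p - \<sigma> (frac (fst p))))" for p
  have frac_b: "(\<lambda>p :: real \<times> real \<times> real. frac (fst p)) \<in> borel_measurable borel"
    unfolding borel_prod[symmetric] frac_def by measurable
  have \<theta>m: "\<theta> \<in> measurable borel ?M"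
    unfolding \<theta>_def[abs_def]
  proof (rule measurable_Pair)
    show "(\<lambda>p. frac (fst p)) \<in> measurable borel circle" 
      by (intro measurable_into_circle borel_measurable_continuous_onI continuous_intros)
    have "(\<lambda>p. \<pi> (snd p - \<sigma> (frac (fst p)))) \<in> borel_measurable borel"
      by (intro measurable_compose[OF _ retraction(1)] borel_measurable_diff measurable_compose[OF frac_b \<sigma>b]
          borel_measurable_continuous_onI continuous_intros)
    then show "(\<lambda>p. \<pi> (snd p - \<sigma> (frac (fst p)))) \<in> measurable borel (haar_of H \<pi>)"
      using retraction(2) by (intro measurable_into_haar_of[OF H \<pi>]) auto
  qed
  define B where "B = \<theta> -` A"
  have Bb: "B \<in> sets borel" using measurable_sets[OF \<theta>m A] by (simp add: B_def)
  have B: "skew_invariant \<alpha> \<Phi> B"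
    unfolding skew_invariant_def
  proof (intro conjI allI Bb)
    fix x y
    show "(x + 1, y) \<in> B \<longleftrightarrow> (x, y) \<in> B" by (simp add: B_def \<theta>_def frac_1_eq)
    have fr: "frac (x + \<alpha>) = frac (frac x + \<alpha>)" by (rule frac_frac_add[symmetric])
    have "y + \<Phi> x - \<sigma> (frac (x + \<alpha>)) = (y - \<sigma> (frac x)) + reduced (frac x)"
      unfolding fr by (simp add: reduced_def rotation_def \<Phi>_frac)
    then have "\<pi> (y + \<Phi> x - \<sigma> (frac (x + \<alpha>))) = \<pi> (y - \<sigma> (frac x)) + reduced (frac x)"
      by (simp only: retraction(3)[OF reduced_H])
    then have "(x + \<alpha>, y + \<Phi> x) \<in> B \<longleftrightarrow> (frac (frac x + \<alpha>), \<pi> (y - \<sigma> (frac x)) + reduced (frac x)) \<in> A"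
      by (simp only: B_def \<theta>_def vimage_eq fst_conv snd_conv fr[symmetric])
    also have "\<dots> \<longleftrightarrow> (frac x, \<pi> (y - \<sigma> (frac x))) \<in> A"
      by (rule inv) (auto simp: frac_lt_1 retraction(2))
    finally show "(x + \<alpha>, y + \<Phi> x) \<in> B \<longleftrightarrow> (x, y) \<in> B" by (simp add: B_def \<theta>_def)
  qed
  \<comment> \<open>A parametrisation of the part of K over [0, 1) by circle x H.\<close>
  define \<kappa> where "\<kappa> z = (fst z, \<sigma> (fst z) + snd z)" for z :: "real \<times> real \<times> real"
  have \<kappa>m: "\<kappa> \<in> borel_measurable ?M"
    unfolding \<kappa>_def[abs_def]
    by (intro borel_measurable_Pair borel_measurable_add measurable_circle_haar_of[OF H \<pi>]
        measurable_compose[OF measurable_circle_haar_of(1)[OF H \<pi>] \<sigma>b])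
  have "\<kappa> z \<in> common_periods \<alpha> \<Phi>" if "z \<in> space ?M" for z
  proof -
    have "snd z \<in> H" using that by (auto simp: sp)
    then have "(fst z, \<sigma> (fst z)) + (0, snd z) \<in> common_periods \<alpha> \<Phi>"
      by (intro common_periods_add \<sigma>K) (simp add: H_def)
    then show ?thesis by (simp add: \<kappa>_def)
  qed
  then have ae: "AE z in ?M. AE p in lborel. p + \<kappa> z \<in> B \<longleftrightarrow> p \<in> B"
    using B unfolding common_periods_def ae_periods_def by (intro AE_I2[of ?M]) blast
  have "{w \<in> space (lborel \<Otimes>\<^sub>M ?M). fst w + \<kappa> (snd w) \<in> B \<longleftrightarrow> fst w \<in> B} \<in> sets (lborel \<Otimes>\<^sub>M ?M)"
  proof -
    have [measurable]: "B \<in> sets borel" "\<kappa> \<in> borel_measurable ?M" using Bb \<kappa>m by auto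
    show ?thesis by measurable
  qed
  \<comment> \<open>Fubini fixes one p whose translates by almost all these elements of K agree with
    p about B.\<close>
  from LM.AE_commute[OF this] ae have "AE p in lborel. AE z in ?M. p + \<kappa> z \<in> B \<longleftrightarrow> p \<in> B" by blast
  then obtain p where p: "AE z in ?M. p + \<kappa> z \<in> B \<longleftrightarrow> p \<in> B" using AE_lborel_witness by blast
  obtain t y where ty: "p = (t, y)" by (cases p)
  define g where "g x = \<pi> (y + \<sigma> x - \<sigma> (frac (x + t)))" for x
  have "(\<lambda>x. frac (x + t)) \<in> borel_measurable borel" unfolding frac_def by measurable
  then have gb: "g \<in> borel_measurable borel"
    unfolding g_def[abs_def] 
    by (intro measurable_compose[OF _ retraction(1)] borel_measurable_diff borel_measurable_add \<sigma>b
        measurable_compose[OF _ \<sigma>b]) auto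
  let ?S = "\<lambda>(x, h). (frac (x + t), h + g x)"
  have S: "?S \<in> measurable ?M ?M" "distr ?M ?M ?S = ?M"
    using skew_measure_preserving[OF H \<pi> gb, of t] retraction(2)
    by (auto simp: measure_preserving_def g_def)
  \<comment> \<open>Through \<theta>, translating p by \<kappa> z becomes a measure-preserving map
    of z, so membership in A is almost everywhere constant.\<close>
  have "p + \<kappa> z \<in> B \<longleftrightarrow> ?S z \<in> A" if "z \<in> space ?M" for z
  proof -
    obtain x h where z: "z = (x, h)" "h \<in> H" using \<open>z \<in> space ?M\<close> sp by auto
    have "y + (\<sigma> x + h) - \<sigma> (frac (t + x)) = (y + \<sigma> x - \<sigma> (frac (x + t))) + h"
      by (simp add: add.commute[of t x])
    then have "\<pi> (y + (\<sigma> x + h) - \<sigma> (frac (t + x))) = g x + h"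
      by (simp only: retraction(3)[OF z(2)] g_def)
    then show ?thesis by (simp add: z ty \<kappa>_def B_def \<theta>_def add.commute[of t x] add.commute[of h "g x"])
  qed
  then have "AE z in ?M. ?S z \<in> A \<longleftrightarrow> p \<in> B" using p by auto
  moreover have "(AE z in distr ?M ?M ?S. z \<in> A \<longleftrightarrow> p \<in> B) \<longleftrightarrow> (AE z in ?M. ?S z \<in> A \<longleftrightarrow> p \<in> B)"
  proof (rule AE_distr_iff[OF S(1)])
    have "{z \<in> space ?M. z \<in> A \<longleftrightarrow> p \<in> B} = (if p \<in> B then A else space ?M - A)"
      using sets.sets_into_space[OF A] by auto
    then show "{z \<in> space ?M. z \<in> A \<longleftrightarrow> p \<in> B} \<in> sets ?M" using A by auto
  qed
  ultimately have "AE z in distr ?M ?M ?S. z \<in> A \<longleftrightarrow> p \<in> B" by blast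
  then have const: "AE z in ?M. z \<in> A \<longleftrightarrow> p \<in> B" by (simp only: S(2))
  show "emeasure ?M A = 0 \<or> emeasure ?M (space ?M - A) = 0"
  proof (cases "p \<in> B")
    case True
    have "AE z in ?M. z \<notin> space ?M - A" using const by eventually_elim (use True in auto)
    then have "space ?M - A \<in> null_sets ?M" using A by (subst AE_iff_null_sets) auto
    then show ?thesis by auto
  next
    case False
    then have "AE z in ?M. z \<notin> A" using const by simp
    then have "A \<in> null_sets ?M" using A by (subst AE_iff_null_sets) auto
    then show ?thesis by auto
  qed
qed

lemma regular_\<Phi>: "regular_cocycle (rotation \<alpha>) \<Phi>"
  unfolding regular_cocycle_def cocycle_def
proof (intro conjI exI)
  show "\<Phi> \<in> borel_measurable circle" "reduced \<in> borel_measurable circle"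
    by (intro measurable_circle \<Phi>b reduced_borel)+
  show "haar_measure_on H (haar_of H \<pi>)" by (rule haar_of_haar[OF closed_subgroup_H \<pi>])
  show "\<forall>x\<in>{0..<1}. reduced x \<in> H" using reduced_H by blast
qed (rule cohomologous_reduced closed_subgroup_H ergodic_reduced)+

end

lemma regular_of_common_periods:
  fixes \<Phi> :: "real \<Rightarrow> real \<times> real"
  assumes \<Phi>b: "\<Phi> \<in> borel_measurable borel" and \<Phi>per: "\<And>x. \<Phi> (x + 1) = \<Phi> x"
    and \<Phi>K: "\<And>x. (\<alpha>, \<Phi> x) \<in> common_periods \<alpha> \<Phi>"
    and ne: "\<And>x. \<exists>y. (x, y) \<in> common_periods \<alpha> \<Phi>"
  shows "regular_cocycle (rotation \<alpha>) \<Phi>"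
proof -
  obtain \<sigma> where \<sigma>: "\<sigma> \<in> borel_measurable borel" "\<And>x. (x, \<sigma> x) \<in> common_periods \<alpha> \<Phi>"
    using borel_selection[OF closed_common_periods ne] by metis
  define H where "H = {h. (0, h) \<in> common_periods \<alpha> \<Phi>}"
  obtain \<pi> where \<pi>: "equivariant_retraction H \<pi>"
    using equivariant_retraction_exists[OF closed_subgroup_vertical_periods] unfolding H_def by blast
  show ?thesis by (rule regular_\<Phi>[OF \<Phi>b \<Phi>per \<Phi>K \<sigma> H_def \<pi>])
qed

section \<open>Cocycles with two steps\<close>

lemma two_step_periodic: "two_step b d u v (x + 1) = two_step b d u v x"
proof -
  have "frac (x + 1 - c) = frac (x - c)" for c :: real
    using frac_1_eq[of "x - c"] by (simp add: algebra_simps)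
  then show ?thesis by (simp add: two_step_def frac_1_eq)
qed

lemma two_step_floor:
  "two_step b d u v x = of_int (\<lfloor>x\<rfloor> - \<lfloor>x - b\<rfloor>) *\<^sub>R u + of_int (\<lfloor>x\<rfloor> - \<lfloor>x - d\<rfloor>) *\<^sub>R v - (b *\<^sub>R u + d *\<^sub>R v)"
  by (simp add: two_step_def frac_def algebra_simps)

context
  fixes \<alpha> b d :: real and u v :: "'b::euclidean_space"
  assumes u: "(0, u) \<in> common_periods \<alpha> (two_step b d u v)"
    and v: "(0, v) \<in> common_periods \<alpha> (two_step b d u v)"
begin

lemma two_step_lattice_period:
  "(0, of_int i *\<^sub>R u + of_int j *\<^sub>R v) \<in> common_periods \<alpha> (two_step b d u v)"
proof -
  have "of_int i *\<^sub>R (0, u) + of_int j *\<^sub>R (0, v) \<in> common_periods \<alpha> (two_step b d u v)"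
    by (intro common_periods_add common_periods_of_int u v)
  then show ?thesis by simp
qed

text \<open>Modulo the lattice of periods, the skew product is a translation.\<close>

lemma two_step_drift_period: "(\<alpha>, - (b *\<^sub>R u + d *\<^sub>R v)) \<in> common_periods \<alpha> (two_step b d u v)"
  unfolding common_periods_def
proof (intro CollectI allI impI)
  fix B assume B: "skew_invariant \<alpha> (two_step b d u v) B"
  define w where "w = b *\<^sub>R u + d *\<^sub>R v"
  \<comment> \<open>All lattice vectors at once: the one needed below depends on the point, and
    there are countably many.\<close>
  have "AE p in lborel. \<forall>i j. p + (0, of_int i *\<^sub>R u + of_int j *\<^sub>R v) \<in> B \<longleftrightarrow> p \<in> B"
    unfolding AE_all_countable
    using two_step_lattice_period B by (auto simp: common_periods_def ae_periods_def)
  from AE_lborel_translate[OF this, of "(\<alpha>, - w)"]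
  have "AE p in lborel. p + (\<alpha>, - w) \<in> B \<longleftrightarrow> p \<in> B"
  proof eventually_elim
    case (elim p)
    obtain x y where p: "p = (x, y)" by fastforce
    have "p + (\<alpha>, - w) + (0, of_int (\<lfloor>x\<rfloor> - \<lfloor>x - b\<rfloor>) *\<^sub>R u + of_int (\<lfloor>x\<rfloor> - \<lfloor>x - d\<rfloor>) *\<^sub>R v)
        = (x + \<alpha>, y + two_step b d u v x)"
      unfolding two_step_floor by (simp add: p w_def)
    with elim have "p + (\<alpha>, - w) \<in> B \<longleftrightarrow> (x + \<alpha>, y + two_step b d u v x) \<in> B" by metis
    then show ?case using B by (simp add: p skew_invariant_def)
  qed
  then show "(\<alpha>, - (b *\<^sub>R u + d *\<^sub>R v)) \<in> ae_periods B" by (simp add: ae_periods_def w_def)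
qed

lemma two_step_in_common_periods:
  "(\<alpha>, two_step b d u v x) \<in> common_periods \<alpha> (two_step b d u v)"
proof -
  have "(\<alpha>, - (b *\<^sub>R u + d *\<^sub>R v)) + (0, of_int (\<lfloor>x\<rfloor> - \<lfloor>x - b\<rfloor>) *\<^sub>R u + of_int (\<lfloor>x\<rfloor> - \<lfloor>x - d\<rfloor>) *\<^sub>R v)
      \<in> common_periods \<alpha> (two_step b d u v)"
    by (intro common_periods_add two_step_drift_period two_step_lattice_period)
  also have "(\<alpha>, - (b *\<^sub>R u + d *\<^sub>R v)) + (0, of_int (\<lfloor>x\<rfloor> - \<lfloor>x - b\<rfloor>) *\<^sub>R u + of_int (\<lfloor>x\<rfloor> - \<lfloor>x - d\<rfloor>) *\<^sub>R v)
      = (\<alpha>, two_step b d u v x)"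
    by (simp add: two_step_floor[of b d u v x] algebra_simps)
  finally show ?thesis .
qed

text \<open>Approximate x by k \<alpha> - h. The corresponding multiples of the drift can be reduced
  modulo the lattice to a bounded second coordinate, so a subsequence converges, and K is
  closed.\<close>

lemma two_step_fibre:
  assumes irr: "\<alpha> \<notin> \<rat>"
  shows "\<exists>y. (x, y) \<in> common_periods \<alpha> (two_step b d u v)"
proof -
  let ?K = "common_periods \<alpha> (two_step b d u v)"
  have "\<exists>h k :: int. \<bar>of_int k * \<alpha> - of_int h - x\<bar> < 1 / real (Suc n)" for n
    using sequence_of_fractional_parts_is_dense[OF irr, of "1 / real (Suc n)" x] by (metis of_nat_0_less_iff zero_less_Suc zero_less_divide_1_iff)
  then obtain h k :: "nat \<Rightarrow> int" where hk: "\<And>n. \<bar>of_int (k n) * \<alpha> - of_int (h n) - x\<bar> < 1 / real (Suc n)"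
    by metis
  define X where "X n = of_int (k n) * \<alpha> - of_int (h n)" for n
  define Y where "Y n = - (frac (of_int (k n) * b) *\<^sub>R u + frac (of_int (k n) * d) *\<^sub>R v)" for n
  have K: "(X n, Y n) \<in> ?K" for n
  proof -
    have "of_int (k n) *\<^sub>R (\<alpha>, - (b *\<^sub>R u + d *\<^sub>R v)) - of_int (h n) *\<^sub>R (1, 0)
        + (0, of_int \<lfloor>of_int (k n) * b\<rfloor> *\<^sub>R u + of_int \<lfloor>of_int (k n) * d\<rfloor> *\<^sub>R v) \<in> ?K"
      by (intro common_periods_add common_periods_diff common_periods_of_int common_periods_one
          two_step_drift_period two_step_lattice_period)
    also have "of_int (k n) *\<^sub>R (\<alpha>, - (b *\<^sub>R u + d *\<^sub>R v)) - of_int (h n) *\<^sub>R (1, 0)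
        + (0, of_int \<lfloor>of_int (k n) * b\<rfloor> *\<^sub>R u + of_int \<lfloor>of_int (k n) * d\<rfloor> *\<^sub>R v) = (X n, Y n)"
      by (simp add: X_def Y_def frac_def algebra_simps)
    finally show ?thesis .
  qed
  have X: "X \<longlonglongrightarrow> x"
  proof (rule LIMSEQ_I)
    fix e :: real assume "0 < e"
    then obtain N where N: "1 / real (Suc N) < e" using nat_approx_posE by blast
    have "norm (X n - x) < e" if "N \<le> n" for n
    proof -
      have "1 / real (Suc n) \<le> 1 / real (Suc N)" using that by (intro divide_left_mono) auto
      with hk[of n] N show ?thesis by (simp add: X_def)
    qed
    then show "\<exists>N. \<forall>n\<ge>N. norm (X n - x) < e" by blast
  qed
  have "Y n \<in> cball 0 (norm u + norm v)" for n
  proof -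
    have "norm (Y n) \<le> norm (frac (of_int (k n) * b) *\<^sub>R u) + norm (frac (of_int (k n) * d) *\<^sub>R v)"
      unfolding Y_def norm_minus_cancel by (rule norm_triangle_ineq)
    also have "\<dots> \<le> 1 * norm u + 1 * norm v"
      unfolding norm_scaleR by (intro add_mono mult_right_mono) (auto simp: less_imp_le frac_lt_1)
    finally show ?thesis by simp
  qed
  then obtain y r where r: "strict_mono r" "(Y \<circ> r) \<longlonglongrightarrow> y"
    using compact_cball[of "0 :: 'b" "norm u + norm v"] unfolding compact_def by blast
  have lim: "(\<lambda>n. (X (r n), Y (r n))) \<longlonglongrightarrow> (x, y)"
    using LIMSEQ_subseq_LIMSEQ[OF X r(1)] r(2) by (intro tendsto_Pair) (auto simp: o_def)
  have "(x, y) \<in> ?K"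
    by (rule closed_sequentially[OF closed_common_periods _ lim]) (rule K)
  then show ?thesis ..
qed

end

lemma regular_two_step:
  fixes u v :: "real \<times> real"
  assumes "\<alpha> \<notin> \<rat>" "(0, u) \<in> common_periods \<alpha> (two_step b d u v)"
    "(0, v) \<in> common_periods \<alpha> (two_step b d u v)"
  shows "regular_cocycle (rotation \<alpha>) (two_step b d u v)"
  by (rule regular_of_common_periods[OF two_step_borel two_step_periodic
        two_step_in_common_periods[OF assms(2,3)] two_step_fibre[OF assms(2,3,1)]])

section \<open>Discontinuities in the same class\<close>

lemma frac_add_of_int: "frac (x + of_int n) = frac (x :: real)"
  by (simp add: frac_def)

text \<open>A function composed with a power of the rotation differs from the function itself by a
  telescoping sum; the sign of k decides on which side the partial sums are taken.\<close>

lemma on_orbit_coboundary: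
  assumes "on_orbit \<alpha> (b - b')"
  obtains f where "f \<in> borel_measurable borel"
    "\<And>x. frac (x - b) - frac (x - b') = f x - f (rotation \<alpha> x)"
proof -
  obtain k z :: int where kz: "b - b' = of_int k * \<alpha> + of_int z" using assms by (auto simp: on_orbit_def)
  define g where "g x = frac (x - b')" for x
  have gb: "(\<lambda>x. g (x + c)) \<in> borel_measurable borel" for c unfolding g_def frac_def by measurable
  have grot: "g (rotation \<alpha> x + c) = g (x + (\<alpha> + c))" for x c
    using frac_frac_add[of "x + \<alpha>" "c - b'"] by (simp add: g_def rotation_def algebra_simps)
  have gk: "frac (x - b) = g (x - of_int k * \<alpha>)" for x
    using frac_add_of_int[of "x - b' - of_int k * \<alpha>" "- z"] kz by (simp add: g_def algebra_simps)
  show thesis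
  proof (cases "0 \<le> k")
    case True
    define m where "m = nat k"
    define f where "f x = (\<Sum>j<m. g (x + - (real (Suc j) * \<alpha>)))" for x
    show thesis
    proof (rule that[of f])
      show "f \<in> borel_measurable borel" unfolding f_def[abs_def] by (intro borel_measurable_sum gb)
      fix x
      have "f (rotation \<alpha> x) = (\<Sum>j<m. g (x + - (real j * \<alpha>)))"
        unfolding f_def grot by (intro sum.cong refl arg_cong[where f = g]) (simp add: algebra_simps)
      then have "f x - f (rotation \<alpha> x) = g (x + - (real m * \<alpha>)) - g (x + - (real 0 * \<alpha>))"
        unfolding f_def by (simp only: sum_subtractf[symmetric] sum_lessThan_telescope[where f = "\<lambda>j. g (x + - (real j * \<alpha>))"])
      then show "frac (x - b) - frac (x - b') = f x - f (rotation \<alpha> x)"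
        using True by (simp add: gk m_def) (simp add: g_def)
    qed
  next
    case False
    define m where "m = nat (- k)"
    define f where "f x = - (\<Sum>j<m. g (x + real j * \<alpha>))" for x
    show thesis
    proof (rule that[of f])
      show "f \<in> borel_measurable borel"
        unfolding f_def[abs_def] by (intro borel_measurable_uminus borel_measurable_sum gb)
      fix x
      have "f (rotation \<alpha> x) = - (\<Sum>j<m. g (x + real (Suc j) * \<alpha>))"
        unfolding f_def grot by (intro arg_cong[where f = uminus] sum.cong refl arg_cong[where f = g]) (simp add: algebra_simps)
      then have "f x - f (rotation \<alpha> x) = (\<Sum>j<m. g (x + real (Suc j) * \<alpha>) - g (x + real j * \<alpha>))"
        unfolding f_def by (simp add: sum_subtractf)
      also have "\<dots> = g (x + real m * \<alpha>) - g (x + real 0 * \<alpha>)"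
        by (rule sum_lessThan_telescope)
      finally show "frac (x - b) - frac (x - b') = f x - f (rotation \<alpha> x)"
        using False by (simp add: gk m_def) (simp add: g_def)
    qed
  qed
qed

lemma regular_cohomologous:
  assumes \<Phi>: "cocycle \<Phi>" and f: "f \<in> borel_measurable circle"
    and eq: "\<And>x. x \<in> {0..<1} \<Longrightarrow> \<Phi> x - \<Phi>' x = f x - f (T x)" and reg: "regular_cocycle T \<Phi>'"
  shows "regular_cocycle T \<Phi>"
proof -
  obtain \<Psi> H \<nu> where reg': "cocycle \<Psi>" "cohomologous T \<Phi>' \<Psi>" "closed_subgroup H"
    "\<forall>x\<in>{0..<1}. \<Psi> x \<in> H" "haar_measure_on H \<nu>" "ergodic (circle \<Otimes>\<^sub>M \<nu>) (skew_product T \<Psi>)"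
    using reg unfolding regular_cocycle_def by blast
  then obtain f' where f': "f' \<in> borel_measurable circle" "AE x in circle. \<Phi>' x - \<Psi> x = f' x - f' (T x)"
    unfolding cohomologous_def by blast
  have "AE x in circle. \<Phi> x - \<Phi>' x = f x - f (T x)" using eq by (intro AE_I2) (simp add: space_circle)
  with f'(2) have "AE x in circle. \<Phi> x - \<Psi> x = (f x + f' x) - (f (T x) + f' (T x))"
  proof eventually_elim
    case (elim x)
    have "\<Phi> x - \<Psi> x = (\<Phi> x - \<Phi>' x) + (\<Phi>' x - \<Psi> x)" by simp
    also have "\<dots> = (f x - f (T x)) + (f' x - f' (T x))" by (simp only: elim)
    finally show ?case by (simp add: algebra_simps)
  qed
  then have "cohomologous T \<Phi> \<Psi>"
    unfolding cohomologous_def using f f'(1) by (intro bexI[of _ "\<lambda>x. f x + f' x"]) auto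
  with \<Phi> reg' show ?thesis unfolding regular_cocycle_def by blast
qed

lemma indicator_eq_frac:
  fixes b x :: real
  assumes "b \<in> {0..<1}" "x \<in> {0..<1}"
  shows "indicator {0..<b} x - b = frac (x - b) - frac x"
proof -
  have "frac x = x" using assms by (simp add: frac_eq)
  moreover have "frac (x - b) = (if x < b then x - b + 1 else x - b)"
    using assms by (auto simp: frac_unique_iff)
  ultimately show ?thesis using assms by (simp add: indicator_def)
qed

lemma regular_two_step_of_on_orbit:
  assumes b: "b \<in> {0..<1}" and d: "d \<in> {0..<1}"
    and orb: "on_orbit \<alpha> (b - b')" "on_orbit \<alpha> (d - d')"
    and reg: "regular_cocycle (rotation \<alpha>) (two_step b' d' (1, 0) (0, 1) :: real \<Rightarrow> real \<times> real)"
  shows "regular_cocycle (rotation \<alpha>)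
    (\<lambda>x. (indicator {0..<b} x - b, indicator {0..<d} x - d) :: real \<times> real)"
proof -
  obtain f where f: "f \<in> borel_measurable borel" "\<And>x. frac (x - b) - frac (x - b') = f x - f (rotation \<alpha> x)"
    using on_orbit_coboundary[OF orb(1)] by blast
  obtain g where g: "g \<in> borel_measurable borel" "\<And>x. frac (x - d) - frac (x - d') = g x - g (rotation \<alpha> x)"
    using on_orbit_coboundary[OF orb(2)] by blast
  show ?thesis
  proof (rule regular_cohomologous[OF _ _ _ reg])
    show "cocycle (\<lambda>x. (indicator {0..<b} x - b, indicator {0..<d} x - d) :: real \<times> real)"
      unfolding cocycle_def by (intro measurable_circle borel_measurable_Pair) measurable
    show "(\<lambda>x. (f x, g x)) \<in> borel_measurable circle"
      by (intro measurable_circle borel_measurable_Pair f g)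
    fix x :: real assume x: "x \<in> {0..<1}"
    show "(indicator {0..<b} x - b, indicator {0..<d} x - d) - two_step b' d' (1, 0) (0, 1) x =
        (f x, g x) - (f (rotation \<alpha> x), g (rotation \<alpha> x))"
      using f(2)[of x] g(2)[of x]
      by (simp add: indicator_eq_frac[OF b x] indicator_eq_frac[OF d x] two_step_def)
  qed
qed

theorem theorem3p12:
  fixes \<alpha> \<beta> \<gamma> :: real
  assumes "\<alpha> \<in> {0<..<1}" and "bounded_type \<alpha>"
    and "\<beta> \<in> {0..<1}" and "\<gamma> \<in> {0..<1}"
  shows "regular_cocycle (rotation \<alpha>)
    (\<lambda>x. (indicator {0..<\<beta>} x - \<beta>, indicator {0..<\<gamma>} x - \<gamma>) :: real \<times> real)"
proof -
  obtain c where bad: "badly_approximable c \<alpha>"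
    using bounded_type_badly_approximable[OF assms(2)] .
  note irr = badly_approximable_irrational[OF bad]
  have orb0: "on_orbit \<alpha> 0" unfolding on_orbit_def by (intro exI[of _ 0]) simp
  have one: "regular_cocycle (rotation \<alpha>) (two_step b b u 0)" if "\<not> on_orbit \<alpha> b" for b and u :: "real \<times> real"
  proof (rule regular_two_step[OF irr _ common_periods_zero_Pair])
    show "(0, u) \<in> common_periods \<alpha> (two_step b b u 0)"
      unfolding common_periods_def using one_step_period[OF bad _ that] by blast
  qed
  note reduce = regular_two_step_of_on_orbit[OF assms(3,4)]
  consider "on_orbit \<alpha> \<beta>" "on_orbit \<alpha> \<gamma>" | "on_orbit \<alpha> \<beta>" "\<not> on_orbit \<alpha> \<gamma>"
    | "\<not> on_orbit \<alpha> \<beta>" "on_orbit \<alpha> \<gamma>" | "\<not> on_orbit \<alpha> \<beta>" "on_orbit \<alpha> (\<gamma> - \<beta>)"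
    | "\<not> on_orbit \<alpha> \<beta>" "\<not> on_orbit \<alpha> \<gamma>" "\<not> on_orbit \<alpha> (\<gamma> - \<beta>)" by blast
  then show ?thesis
  proof cases
    case 1
    \<comment> \<open>Both steps at 0 vanish whatever their directions are; zero directions make the
      period hypotheses trivial.\<close>
    have "regular_cocycle (rotation \<alpha>) (two_step 0 0 0 0 :: real \<Rightarrow> real \<times> real)"
      by (intro regular_two_step[OF irr] common_periods_zero_Pair)
    moreover have "two_step 0 0 0 0 = (two_step 0 0 (1, 0) (0, 1) :: real \<Rightarrow> real \<times> real)"
      by (simp add: two_step_def fun_eq_iff zero_prod_def)
    ultimately show ?thesis using 1 by (intro reduce[of \<alpha> 0 0]) auto
  next
    case 2
    have "two_step \<gamma> \<gamma> (0, 1) 0 = (two_step 0 \<gamma> (1, 0) (0, 1) :: real \<Rightarrow> real \<times> real)"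
      by (simp add: two_step_def fun_eq_iff zero_prod_def)
    with one[OF 2(2), of "(0, 1)"] 2 orb0 show ?thesis by (intro reduce[of \<alpha> 0 \<gamma>]) auto
  next
    case 3
    have "two_step \<beta> \<beta> (1, 0) 0 = (two_step \<beta> 0 (1, 0) (0, 1) :: real \<Rightarrow> real \<times> real)"
      by (simp add: two_step_def fun_eq_iff zero_prod_def)
    with one[OF 3(1), of "(1, 0)"] 3 orb0 show ?thesis by (intro reduce[of \<alpha> \<beta> 0]) auto
  next
    case 4
    \<comment> \<open>Once \<gamma> is replaced by \<beta>, the two coordinates jump together, in
      direction (1, 1).\<close>
    have "two_step \<beta> \<beta> (1, 1) 0 = (two_step \<beta> \<beta> (1, 0) (0, 1) :: real \<Rightarrow> real \<times> real)"
      by (simp add: two_step_def fun_eq_iff zero_prod_def)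
    with one[OF 4(1), of "(1, 1)"] 4 orb0 show ?thesis by (intro reduce[of \<alpha> \<beta> \<beta>]) auto
  next
    case 5
    have "\<not> on_orbit \<alpha> (\<beta> - \<gamma>)"
    proof
      assume "on_orbit \<alpha> (\<beta> - \<gamma>)"
      then obtain k z :: int where "\<beta> - \<gamma> = of_int k * \<alpha> + of_int z" by (auto simp: on_orbit_def)
      then have "\<gamma> - \<beta> = of_int (- k) * \<alpha> + of_int (- z)" by simp
      with 5(3) show False unfolding on_orbit_def by blast
    qed
    then have "(0, (1, 0)) \<in> common_periods \<alpha> (two_step \<beta> \<gamma> (1, 0) (0, 1) :: real \<Rightarrow> real \<times> real)"
      "(0, (0, 1)) \<in> common_periods \<alpha> (two_step \<beta> \<gamma> (1, 0) (0, 1) :: real \<Rightarrow> real \<times> real)"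
      unfolding common_periods_def using two_step_periods[OF bad _ 5(1,2)] by blast+
    then have "regular_cocycle (rotation \<alpha>) (two_step \<beta> \<gamma> (1, 0) (0, 1) :: real \<Rightarrow> real \<times> real)"
      by (rule regular_two_step[OF irr])
    with orb0 show ?thesis by (intro reduce[of \<alpha> \<beta> \<gamma>]) auto
  qed
qed

end
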